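(* Let $N,n,k$ be positive integers and $L=\lfloor N/n\rfloor$. The maps $p_N:\widetilde{\mathcal H}_{N+n}(n,k)\to\widetilde{\mathcal H}_N(n,k)$ and $\sigma_N:\widetilde{\mathcal H}_N(n,k)\to\widetilde{\mathcal H}_{N+n}(n,k)$ are $Y(\mathfrak{gl}_n)$-module maps with respect to the actions $\widetilde T^a_b(u)$, i.e. for all $1\le a,b\le n$ $$p_N\circ{}^{L+1}\widetilde T^a_b(u)={}^L\widetilde T^a_b(u)\circ p_N,\qquad\sigma_N\circ{}^L\widetilde T^a_b(u)={}^{L+1}\widetilde T^a_b(u)\circ\sigma_N.$$
   Context: For $N\ge1$ let $\mathbb C[X,A]$ be the polynomial ring in the entries of an $N\times N$ matrix $X=(X^i_j)$ and an $n\times N$ matrix $A=(A^a_i)$, and $\widetilde{\mathcal H}_N(n,k)=\mathcal H_N(n,k)=\{f: f(gXg^{-1},Ag^{-1})=\det(g)^{-k}f(X,A)\ \forall g\in GL_N(\mathbb C)\}$ (as vector spaces), with the Hermitian inner product restricted from $\mathbb C[X,A]$ for which $\langle1,1\rangle=1$ and multiplication by each variable is adjoint to the corresponding partial derivative. $p_N$ is the (well defined, surjective) map characterized by $f(\mathrm{diag}(X,0_{n\times n}),(A\,|\,\eta))=\det(X)^k\det(\eta)^kp_N(f)(X,A)$ for $f\in\mathcal H_{N+n}(n,k)$, with $X$ of size $N\times N$, $A$ of size $n\times N$, $\eta$ of size $n\times n$. $\sigma_N$ is the section of $p_N$ with image $\ker(p_N)^\perp$. Put $Y^i_j=\partial/\partial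 X^j_i$, $B^i_a=\partial/\partial A^a_i$; matrix products of operators keep the written order. On $\widetilde{\mathcal H}_N(n,k)$, with $L=\lfloor N/n\rfloor$, define $${}^L\widetilde T^a_b(u)=\left[\delta^a_b+A^a\frac1{u+(k+n)L-XY}B_b\right]\prod_{j=1}^L\frac{u+(n+k)j}{u+k+(n+k)j}$$ as a power series in $u^{-1}$, where $A^a\frac1{v-XY}B_b=\sum_{s\ge0}v^{-s-1}A^a_i((XY)^s)^i_jB^j_b$. These operators satisfy the RTT relations $(u-v)[T^a_b(u),T^c_d(v)]=T^c_b(u)T^a_d(v)-T^c_b(v)T^a_d(u)$ of the Yangian $Y(\mathfrak{gl}_n)$. *)

theory Defs
  imports
    "HOL-Library.Poly_Mapping"
    "HOL-Library.FuncSet"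
    "HOL-Computational_Algebra.Formal_Power_Series"
    "Jordan_Normal_Form.Determinant"
begin

section \<open>The polynomial rings \<open>\<complex>[X, A]\<close>\<close>

text \<open>
  All indices are zero-based: \<open>XV i j\<close> stands for \<open>X\<^sup>i\<^sub>j\<close> and \<open>AV a i\<close> for \<open>A\<^sup>a\<^sub>i\<close> (upper index, that is
  the row, first).  The rings for all \<open>N\<close> live in one type of polynomials over infinitely many
  variables; \<open>polyring n N\<close> consists of the polynomials that only involve the entries of an
  \<open>N \<times> N\<close> matrix \<open>X\<close> and an \<open>n \<times> N\<close> matrix \<open>A\<close>.
\<close>

datatype mvar = XV nat nat | AV nat nat

type_synonym cpoly = "(mvar \<Rightarrow>\<^sub>0 nat) \<Rightarrow>\<^sub>0 complex"

definition Const :: "complex \<Rightarrow> cpoly" where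
  "Const c = Poly_Mapping.single 0 c"

definition Var :: "mvar \<Rightarrow> cpoly" where
  "Var v = Poly_Mapping.single (Poly_Mapping.single v 1) 1"

definition mvars :: "nat \<Rightarrow> nat \<Rightarrow> mvar set" where
  "mvars n N = {XV i j | i j. i < N \<and> j < N} \<union> {AV a i | a i. a < n \<and> i < N}"

definition polyring :: "nat \<Rightarrow> nat \<Rightarrow> cpoly set" where
  "polyring n N = {f. \<forall>m\<in>Poly_Mapping.keys f. Poly_Mapping.keys m \<subseteq> mvars n N}"

text \<open>
  The partial derivative.  In a monomial \<open>m\<close> that does not contain \<open>v\<close> the coefficient
  \<open>lookup m v\<close> is zero, so the truncated subtraction of exponents does no harm.
\<close>

definition pderiv_var :: "mvar \<Rightarrow> cpoly \<Rightarrow> cpoly" where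
  "pderiv_var v f = (\<Sum>m\<in>Poly_Mapping.keys f.
     Poly_Mapping.single (m - Poly_Mapping.single v 1)
       (of_nat (Poly_Mapping.lookup m v) * Poly_Mapping.lookup f m))"

fun entry :: "complex mat \<Rightarrow> complex mat \<Rightarrow> mvar \<Rightarrow> complex" where
  "entry X A (XV i j) = X $$ (i, j)"
| "entry X A (AV a i) = A $$ (a, i)"

definition eval_at :: "cpoly \<Rightarrow> complex mat \<Rightarrow> complex mat \<Rightarrow> complex" where
  "eval_at f X A = (\<Sum>m\<in>Poly_Mapping.keys f. Poly_Mapping.lookup f m *
     (\<Prod>v\<in>Poly_Mapping.keys m. entry X A v ^ Poly_Mapping.lookup m v))"


section \<open>The spaces \<open>\<H>\<^sub>N(n, k)\<close>\<close>

text \<open>\<open>h\<close> plays the role of \<open>g\<inverse>\<close>.\<close>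

definition Hspace :: "nat \<Rightarrow> nat \<Rightarrow> nat \<Rightarrow> cpoly set" where
  "Hspace n k N = {f \<in> polyring n N.
     \<forall>g \<in> carrier_mat N N. \<forall>h \<in> carrier_mat N N. inverts_mat g h \<and> inverts_mat h g \<longrightarrow>
       (\<forall>X \<in> carrier_mat N N. \<forall>A \<in> carrier_mat n N.
          eval_at f (g * X * h) (A * h) = det g powi (- int k) * eval_at f X A)}"

text \<open>
  A Hermitian inner product on \<open>\<complex>[X, A]\<close>, linear in the first argument, with \<open>\<langle>1, 1\<rangle> = 1\<close> and
  multiplication by every variable adjoint to the corresponding partial derivative.  These
  conditions determine \<open>ip\<close> on \<open>polyring n N\<close>; existence is lemma \<open>fock_inner_exists\<close> below.
\<close>

definition fock_inner :: "nat \<Rightarrow> nat \<Rightarrow> (cpoly \<Rightarrow> cpoly \<Rightarrow> complex) \<Rightarrow> bool" where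
  "fock_inner n N ip \<longleftrightarrow>
     (\<forall>f\<in>polyring n N. \<forall>g\<in>polyring n N. \<forall>h\<in>polyring n N. ip (f + g) h = ip f h + ip g h) \<and>
     (\<forall>c. \<forall>f\<in>polyring n N. \<forall>g\<in>polyring n N. ip (Const c * f) g = c * ip f g) \<and>
     (\<forall>f\<in>polyring n N. \<forall>g\<in>polyring n N. ip g f = cnj (ip f g)) \<and>
     (\<forall>f\<in>polyring n N. f \<noteq> 0 \<longrightarrow> 0 < Re (ip f f)) \<and>
     ip 1 1 = 1 \<and>
     (\<forall>v\<in>mvars n N. \<forall>f\<in>polyring n N. \<forall>g\<in>polyring n N.
        ip (Var v * f) g = ip f (pderiv_var v g))"


section \<open>The maps \<open>p\<^sub>N\<close> and \<open>\<sigma>\<^sub>N\<close>\<close>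

text \<open>
  \<open>pmap n k N\<close> is \<open>p\<^sub>N\<close>; it is meaningful on \<open>Hspace n k (N + n)\<close> only.  The second block matrix
  is \<open>(A | \<eta>)\<close>: its lower blocks have no rows.
\<close>

definition pmap :: "nat \<Rightarrow> nat \<Rightarrow> nat \<Rightarrow> cpoly \<Rightarrow> cpoly" where
  "pmap n k N f = (THE q. q \<in> Hspace n k N \<and>
     (\<forall>X \<in> carrier_mat N N. \<forall>A \<in> carrier_mat n N. \<forall>\<eta> \<in> carrier_mat n n.
        eval_at f (four_block_mat X (0\<^sub>m N n) (0\<^sub>m n N) (0\<^sub>m n n))
                  (four_block_mat A \<eta> (0\<^sub>m 0 N) (0\<^sub>m 0 n))
        = det X ^ k * det \<eta> ^ k * eval_at q X A))"

definition pker :: "nat \<Rightarrow> nat \<Rightarrow> nat \<Rightarrow> cpoly set" where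
  "pker n k N = {f \<in> Hspace n k (N + n). pmap n k N f = 0}"

definition pker_perp ::
    "(cpoly \<Rightarrow> cpoly \<Rightarrow> complex) \<Rightarrow> nat \<Rightarrow> nat \<Rightarrow> nat \<Rightarrow> cpoly set" where
  "pker_perp ip n k N = {f \<in> Hspace n k (N + n). \<forall>h \<in> pker n k N. ip f h = 0}"

definition perp_section ::
    "(cpoly \<Rightarrow> cpoly \<Rightarrow> complex) \<Rightarrow> nat \<Rightarrow> nat \<Rightarrow> nat \<Rightarrow> (cpoly \<Rightarrow> cpoly) \<Rightarrow> bool" where
  "perp_section ip n k N \<sigma> \<longleftrightarrow>
     (\<forall>f \<in> Hspace n k N. pmap n k N (\<sigma> f) = f) \<and>
     \<sigma> ` Hspace n k N = pker_perp ip n k N"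


section \<open>The operators \<open>T\<^sup>a\<^sub>b(u)\<close>\<close>

definition Yop :: "nat \<Rightarrow> nat \<Rightarrow> cpoly \<Rightarrow> cpoly" where
  "Yop i j = pderiv_var (XV j i)"

definition Bop :: "nat \<Rightarrow> nat \<Rightarrow> cpoly \<Rightarrow> cpoly" where
  "Bop i a = pderiv_var (AV a i)"

definition XYop :: "nat \<Rightarrow> nat \<Rightarrow> nat \<Rightarrow> cpoly \<Rightarrow> cpoly" where
  "XYop N i j f = (\<Sum>l<N. Var (XV i l) * Yop l j f)"

fun XYpow :: "nat \<Rightarrow> nat \<Rightarrow> nat \<Rightarrow> nat \<Rightarrow> cpoly \<Rightarrow> cpoly" where
  "XYpow N 0 i j f = (if i = j then f else 0)"
| "XYpow N (Suc s) i j f = (\<Sum>l<N. XYop N i l (XYpow N s l j f))"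

definition AXYB :: "nat \<Rightarrow> nat \<Rightarrow> nat \<Rightarrow> nat \<Rightarrow> cpoly \<Rightarrow> cpoly" where
  "AXYB N s a b f = (\<Sum>i<N. \<Sum>j<N. Var (AV a i) * XYpow N s i j (Bop j b f))"

text \<open>
  With \<open>t = u\<inverse>\<close> the expansions in powers of \<open>u\<inverse>\<close> of scalar functions of \<open>u\<close> are
  \<open>1 / (u + c) = t / (1 + c t)\<close> and \<open>(u + c) / (u + d) = (1 + c t) / (1 + d t)\<close>.
\<close>

definition inv_shift :: "complex \<Rightarrow> complex fps" where
  "inv_shift c = fps_X * inverse (1 + fps_const c * fps_X)"

definition prefactor :: "nat \<Rightarrow> nat \<Rightarrow> nat \<Rightarrow> complex fps" where
  "prefactor n k L = (\<Prod>j=1..L.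
     (1 + fps_const (of_nat ((n + k) * j)) * fps_X) *
     inverse (1 + fps_const (of_nat (k + (n + k) * j)) * fps_X))"

text \<open>
  \<open>Tbracket n k L N a b r\<close> is the coefficient of \<open>u\<^bsup>-r\<^esup>\<close> in
  \<open>\<delta>\<^sup>a\<^sub>b + A\<^sup>a 1/(u + (k+n)L - XY) B\<^sub>b\<close>.  With \<open>v = u + (k+n)L\<close> the series \<open>v\<^bsup>-s-1\<^esup>\<close> starts in degree
  \<open>s + 1\<close>, so only the terms with \<open>s < r\<close> contribute.  \<open>Tcoeff\<close> is the coefficient of \<open>u\<^bsup>-r\<^esup>\<close> in
  the operator \<open>T\<^sup>a\<^sub>b(u)\<close>, prefactor included, on \<open>\<complex>[X, A]\<close>.
\<close>

definition Tbracket ::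
    "nat \<Rightarrow> nat \<Rightarrow> nat \<Rightarrow> nat \<Rightarrow> nat \<Rightarrow> nat \<Rightarrow> nat \<Rightarrow> cpoly \<Rightarrow> cpoly" where
  "Tbracket n k L N a b r f =
     (if r = 0 \<and> a = b then f else 0) +
     (\<Sum>s<r. Const (fps_nth (inv_shift (of_nat ((k + n) * L)) ^ (s + 1)) r) * AXYB N s a b f)"

definition Tcoeff ::
    "nat \<Rightarrow> nat \<Rightarrow> nat \<Rightarrow> nat \<Rightarrow> nat \<Rightarrow> nat \<Rightarrow> nat \<Rightarrow> cpoly \<Rightarrow> cpoly" where
  "Tcoeff n k L N a b r f =
     (\<Sum>i\<le>r. Const (fps_nth (prefactor n k L) i) * Tbracket n k L N a b (r - i) f)"

text \<open>
  A module map for the algebra generated by the coefficients of the series \<open>T\<^sup>a\<^sub>b(u)\<close>, \<open>a, b < n\<close>: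
  a linear map \<open>V \<rightarrow> W\<close> that intertwines all of them.
\<close>

definition yangian_hom ::
    "nat \<Rightarrow> cpoly set \<Rightarrow> (nat \<Rightarrow> nat \<Rightarrow> nat \<Rightarrow> cpoly \<Rightarrow> cpoly) \<Rightarrow>
     cpoly set \<Rightarrow> (nat \<Rightarrow> nat \<Rightarrow> nat \<Rightarrow> cpoly \<Rightarrow> cpoly) \<Rightarrow> (cpoly \<Rightarrow> cpoly) \<Rightarrow> bool" where
  "yangian_hom n V T W S \<phi> \<longleftrightarrow>
     \<phi> \<in> V \<rightarrow> W \<and>
     (\<forall>f\<in>V. \<forall>g\<in>V. \<phi> (f + g) = \<phi> f + \<phi> g) \<and>
     (\<forall>c. \<forall>f\<in>V. \<phi> (Const c * f) = Const c * \<phi> f) \<and>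
     (\<forall>a<n. \<forall>b<n. \<forall>r. \<forall>f\<in>V. \<phi> (T a b r f) = S a b r (\<phi> f))"


section \<open>Existence of the inner product\<close>

text \<open>The monomials are orthogonal and \<open>\<langle>x\<^sup>m, x\<^sup>m\<rangle> = m!\<close>.\<close>

definition mfact :: "(mvar \<Rightarrow>\<^sub>0 nat) \<Rightarrow> complex" where
  "mfact m = of_nat (\<Prod>v\<in>Poly_Mapping.keys m. fact (Poly_Mapping.lookup m v))"

definition mono_ip :: "cpoly \<Rightarrow> cpoly \<Rightarrow> complex" where
  "mono_ip f g = (\<Sum>m\<in>Poly_Mapping.keys f.
     Poly_Mapping.lookup f m * cnj (Poly_Mapping.lookup g m) * mfact m)"

lemma mfact_superset:
  assumes "finite S" "Poly_Mapping.keys m \<subseteq> S"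
  shows "mfact m = of_nat (\<Prod>v\<in>S. fact (Poly_Mapping.lookup m v))"
  unfolding mfact_def using assms
  by (intro arg_cong[where f = of_nat] prod.mono_neutral_left) (auto simp: in_keys_iff)

lemma mfact_shift:
  "mfact (m + Poly_Mapping.single v 1) = of_nat (Poly_Mapping.lookup m v + 1) * mfact m"
proof -
  let ?S = "insert v (Poly_Mapping.keys m)"
  let ?m = "m + Poly_Mapping.single v (1::nat)"
  have k: "Poly_Mapping.keys ?m \<subseteq> ?S"
    using Poly_Mapping.keys_add[of m "Poly_Mapping.single v 1"] by auto
  have other: "(\<Prod>w\<in>?S - {v}. fact (Poly_Mapping.lookup ?m w)) =
      (\<Prod>w\<in>?S - {v}. fact (Poly_Mapping.lookup m w) :: nat)"
    by (intro prod.cong) (auto simp: lookup_add lookup_single when_def)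
  have "mfact ?m = of_nat (\<Prod>w\<in>?S. fact (Poly_Mapping.lookup ?m w))"
    by (rule mfact_superset) (use k in auto)
  also have "(\<Prod>w\<in>?S. fact (Poly_Mapping.lookup ?m w)) =
      fact (Poly_Mapping.lookup ?m v) * (\<Prod>w\<in>?S - {v}. fact (Poly_Mapping.lookup ?m w) :: nat)"
    by (rule prod.remove) auto
  also have "\<dots> = (Poly_Mapping.lookup m v + 1) *
      (fact (Poly_Mapping.lookup m v) * (\<Prod>w\<in>?S - {v}. fact (Poly_Mapping.lookup m w) :: nat))"
    unfolding other by (simp add: lookup_add algebra_simps)
  also have "fact (Poly_Mapping.lookup m v) * (\<Prod>w\<in>?S - {v}. fact (Poly_Mapping.lookup m w) :: nat) =
      (\<Prod>w\<in>?S. fact (Poly_Mapping.lookup m w))"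
    by (rule prod.remove[symmetric]) auto
  also have "of_nat ((Poly_Mapping.lookup m v + 1) * (\<Prod>w\<in>?S. fact (Poly_Mapping.lookup m w))) =
      of_nat (Poly_Mapping.lookup m v + 1) * mfact m"
    by (simp only: of_nat_mult mfact_superset[of ?S m, OF _ subset_insertI] finite_insert finite_keys)
  finally show ?thesis .
qed

lemma lookup_pderiv_var:
  "Poly_Mapping.lookup (pderiv_var v g) m =
     of_nat (Poly_Mapping.lookup m v + 1) * Poly_Mapping.lookup g (m + Poly_Mapping.single v 1)"
proof -
  let ?e = "Poly_Mapping.single v (1::nat)"
  have eq: "n - ?e = m \<longleftrightarrow> n = m + ?e" if "Poly_Mapping.lookup n v \<noteq> 0" for n
  proof
    assume h: "n - ?e = m"
    show "n = m + ?e"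
      unfolding h[symmetric]
      by (rule poly_mapping_eqI)
        (use that in \<open>auto simp: lookup_add lookup_minus lookup_single when_def\<close>)
  qed auto
  have "Poly_Mapping.lookup (pderiv_var v g) m =
      (\<Sum>n\<in>Poly_Mapping.keys g. of_nat (Poly_Mapping.lookup n v) * Poly_Mapping.lookup g n when n - ?e = m)"
    unfolding pderiv_var_def lookup_sum lookup_single by (simp add: when_def)
  also have "\<dots> = (\<Sum>n\<in>Poly_Mapping.keys g.
      if n = m + ?e then of_nat (Poly_Mapping.lookup n v) * Poly_Mapping.lookup g n else 0)"
    by (intro sum.cong refl) (use eq in \<open>auto simp: when_def\<close>)
  also have "\<dots> = of_nat (Poly_Mapping.lookup m v + 1) * Poly_Mapping.lookup g (m + ?e)"
    by (auto simp: lookup_add in_keys_iff)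
  finally show ?thesis .
qed

lemma mono_ip_superset:
  assumes "finite S" "Poly_Mapping.keys f \<subseteq> S"
  shows "mono_ip f g = (\<Sum>m\<in>S. Poly_Mapping.lookup f m * cnj (Poly_Mapping.lookup g m) * mfact m)"
  unfolding mono_ip_def using assms by (intro sum.mono_neutral_left) (auto simp: in_keys_iff)

lemma mono_ip_add: "mono_ip (f + g) h = mono_ip f h + mono_ip g h"
proof -
  let ?S = "Poly_Mapping.keys f \<union> Poly_Mapping.keys g"
  have "mono_ip u h = (\<Sum>m\<in>?S. Poly_Mapping.lookup u m * cnj (Poly_Mapping.lookup h m) * mfact m)"
    if "u \<in> {f, g, f + g}" for u
    by (rule mono_ip_superset) (use that Poly_Mapping.keys_add[of f g] in auto)
  then show ?thesis
    by (simp add: lookup_add sum.distrib[symmetric] algebra_simps)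
qed

lemma mono_ip_zero: "mono_ip 0 g = 0"
  by (simp add: mono_ip_def)

lemma mono_ip_sum: "mono_ip (\<Sum>x\<in>S. F x) g = (\<Sum>x\<in>S. mono_ip (F x) g)"
  by (induction S rule: infinite_finite_induct) (simp_all add: mono_ip_add mono_ip_zero)

lemma mono_ip_single:
  "mono_ip (Poly_Mapping.single m c) g = c * cnj (Poly_Mapping.lookup g m) * mfact m"
  by (subst mono_ip_superset[of "{m}"]) auto

lemma cpoly_monomials:
  "(\<Sum>m\<in>Poly_Mapping.keys f. Poly_Mapping.single m (Poly_Mapping.lookup f m)) = (f :: cpoly)"
  by (rule poly_mapping_eqI)
    (simp add: lookup_sum lookup_single when_def in_keys_iff)

lemma mono_ip_Const: "mono_ip (Const c * f) g = c * mono_ip f g"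
proof -
  have "Const c * f = (\<Sum>m\<in>Poly_Mapping.keys f. Poly_Mapping.single m (c * Poly_Mapping.lookup f m))"
    by (subst (1) cpoly_monomials[symmetric]) (simp add: Const_def sum_distrib_left mult_single)
  then have "mono_ip (Const c * f) g = (\<Sum>m\<in>Poly_Mapping.keys f.
      c * Poly_Mapping.lookup f m * cnj (Poly_Mapping.lookup g m) * mfact m)"
    by (simp only: mono_ip_sum mono_ip_single)
  then show ?thesis
    by (simp add: mono_ip_def sum_distrib_left mult.assoc)
qed

lemma mono_ip_Var: "mono_ip (Var v * f) g = mono_ip f (pderiv_var v g)"
proof -
  have "Var v * f = (\<Sum>m\<in>Poly_Mapping.keys f.
      Poly_Mapping.single (m + Poly_Mapping.single v 1) (Poly_Mapping.lookup f m))"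
    by (subst (1) cpoly_monomials[symmetric])
      (simp add: Var_def sum_distrib_left mult_single add.commute)
  then have "mono_ip (Var v * f) g = (\<Sum>m\<in>Poly_Mapping.keys f. Poly_Mapping.lookup f m *
      cnj (Poly_Mapping.lookup g (m + Poly_Mapping.single v 1)) *
      (of_nat (Poly_Mapping.lookup m v + 1) * mfact m))"
    by (simp only: mono_ip_sum mono_ip_single mfact_shift)
  also have "\<dots> = mono_ip f (pderiv_var v g)"
    unfolding mono_ip_def lookup_pderiv_var by (intro sum.cong) (simp_all add: ac_simps)
  finally show ?thesis .
qed

lemma mono_ip_cnj: "mono_ip g f = cnj (mono_ip f g)"
proof -
  let ?S = "Poly_Mapping.keys f \<union> Poly_Mapping.keys g"
  have "mono_ip f g = (\<Sum>m\<in>?S. Poly_Mapping.lookup f m * cnj (Poly_Mapping.lookup g m) * mfact m)"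
       "mono_ip g f = (\<Sum>m\<in>?S. Poly_Mapping.lookup g m * cnj (Poly_Mapping.lookup f m) * mfact m)"
    by (rule mono_ip_superset; auto)+
  then show ?thesis
    by (simp add: mfact_def mult.commute)
qed

lemma mono_ip_pos:
  assumes "f \<noteq> 0"
  shows "0 < Re (mono_ip f f)"
proof -
  have "mono_ip f f = of_real (\<Sum>m\<in>Poly_Mapping.keys f. (cmod (Poly_Mapping.lookup f m))\<^sup>2 *
      of_nat (\<Prod>v\<in>Poly_Mapping.keys m. fact (Poly_Mapping.lookup m v)))"
    unfolding mono_ip_def mfact_def
    by (simp add: complex_norm_square[symmetric] del: of_nat_prod)
  moreover have "0 < (\<Sum>m\<in>Poly_Mapping.keys f. (cmod (Poly_Mapping.lookup f m))\<^sup>2 *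
      of_nat (\<Prod>v\<in>Poly_Mapping.keys m. fact (Poly_Mapping.lookup m v) :: nat) :: real)"
    by (rule sum_pos) (use assms in \<open>auto simp: in_keys_iff intro!: mult_pos_pos prod_pos simp del: of_nat_prod\<close>)
  ultimately show ?thesis by (simp only: Re_complex_of_real)
qed

lemma fock_inner_exists: "\<exists>ip. fock_inner n N ip"
proof
  have "mono_ip 1 1 = 1"
    unfolding single_one[symmetric] mono_ip_single by (simp add: mfact_def)
  then show "fock_inner n N mono_ip"
    unfolding fock_inner_def
    by (auto simp: mono_ip_add mono_ip_Const mono_ip_Var mono_ip_pos intro: mono_ip_cnj)
qed

end

theory Submission
  imports Defs "Jordan_Normal_Form.Char_Poly"
begin

text \<open>
  Conjugating by block lower triangular matrices shows that \<open>p\<^sub>N\<close> is restriction to a slice: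
  \<open>p\<^sub>N(f)(X, A) = f(X', A')\<close>, where \<open>X'\<close> has block rows \<open>(X, 0)\<close> and \<open>(A, 0)\<close> and \<open>A' = (0 | 1)\<close>.
  On the slice the last block column of \<open>X'\<close> vanishes, so \<open>X'Y'\<close> only differentiates along the
  slice, and the one transversal derivative \<open>B'\<^sub>b f\<close> is eliminated by the infinitesimal
  equivariance of \<open>f\<close>.  With \<open>q = p\<^sub>N(f)\<close> this writes the restriction of
  \<open>A'\<^sup>a (X'Y')\<^sup>s B'\<^sub>b f\<close> as \<open>A\<^sup>a V\<^sub>s\<close>, plus \<open>k \<delta>\<^sup>a\<^sub>b q\<close> if \<open>s = 0\<close>, where \<open>V\<^sub>0 = B\<^sub>b q\<close>,
  \<open>V\<^sub>1 = (M + k) V\<^sub>0\<close>, \<open>V\<^sub>s\<^sub>+\<^sub>1 = M V\<^sub>s\<close> for \<open>s \<ge> 1\<close> and \<open>M = YX + BA\<close>.  On equivariant vectors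
  \<open>M = XY + k + n\<close>, again by infinitesimal equivariance; summing over \<open>s\<close> gives the shift of the
  spectral parameter by \<open>k + n\<close> and the ratio of the two prefactors.

  For \<open>\<sigma>\<^sub>N\<close>: the kernel of \<open>p\<^sub>N\<close> is stable under each \<open>A\<^sup>a (XY)\<^sup>s B\<^sub>b\<close>, whose adjoint is
  \<open>A\<^sup>b (XY)\<^sup>s B\<^sub>a\<close>, so the orthogonal complement of the kernel is stable too, and \<open>p\<^sub>N\<close> is injective on
  it.
\<close>

section \<open>Evaluation, substitution and directional derivatives\<close>

text \<open>Evaluation at an assignment of all variables instead of a pair of matrices. It is a ring
  homomorphism without any dimension conditions, and \<open>eval_at\<close> is the case
  \<open>entry X A\<close>.\<close>

definition ev :: "(mvar \<Rightarrow> complex) \<Rightarrow> cpoly \<Rightarrow> complex" where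
  "ev \<rho> f = (\<Sum>m\<in>Poly_Mapping.keys f. Poly_Mapping.lookup f m *
     (\<Prod>v\<in>Poly_Mapping.keys m. \<rho> v ^ Poly_Mapping.lookup m v))"

definition psubst :: "(mvar \<Rightarrow> cpoly) \<Rightarrow> cpoly \<Rightarrow> cpoly" where
  "psubst s f = (\<Sum>m\<in>Poly_Mapping.keys f. Const (Poly_Mapping.lookup f m) *
     (\<Prod>v\<in>Poly_Mapping.keys m. s v ^ Poly_Mapping.lookup m v))"

lemma eval_at_eq_ev: "eval_at f X A = ev (entry X A) f"
  by (simp add: eval_at_def ev_def)

lemma monomial_prod_superset:
  fixes \<rho> :: "mvar \<Rightarrow> 'a::comm_semiring_1"
  assumes "finite S" "Poly_Mapping.keys m \<subseteq> S"
  shows "(\<Prod>v\<in>Poly_Mapping.keys m. \<rho> v ^ Poly_Mapping.lookup m v) =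
    (\<Prod>v\<in>S. \<rho> v ^ Poly_Mapping.lookup m v)"
  using assms by (intro prod.mono_neutral_left) (auto simp: in_keys_iff)

lemma ev_superset:
  assumes "finite S" "Poly_Mapping.keys f \<subseteq> S"
  shows "ev \<rho> f = (\<Sum>m\<in>S. Poly_Mapping.lookup f m *
     (\<Prod>v\<in>Poly_Mapping.keys m. \<rho> v ^ Poly_Mapping.lookup m v))"
  unfolding ev_def using assms by (intro sum.mono_neutral_left) (auto simp: in_keys_iff)

lemma ev_zero [simp]: "ev \<rho> 0 = 0"
  by (simp add: ev_def)

lemma ev_single:
  "ev \<rho> (Poly_Mapping.single m c) = c * (\<Prod>v\<in>Poly_Mapping.keys m. \<rho> v ^ Poly_Mapping.lookup m v)"
  by (subst ev_superset[of "{m}"]) auto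

lemma ev_add [simp]: "ev \<rho> (f + g) = ev \<rho> f + ev \<rho> g"
proof -
  let ?S = "Poly_Mapping.keys f \<union> Poly_Mapping.keys g"
  have "ev \<rho> u = (\<Sum>m\<in>?S. Poly_Mapping.lookup u m *
     (\<Prod>v\<in>Poly_Mapping.keys m. \<rho> v ^ Poly_Mapping.lookup m v))" if "u \<in> {f, g, f + g}" for u
    by (rule ev_superset) (use that Poly_Mapping.keys_add[of f g] in auto)
  then show ?thesis
    by (simp add: lookup_add sum.distrib[symmetric] algebra_simps)
qed

lemma ev_sum [simp]: "ev \<rho> (\<Sum>x\<in>S. F x) = (\<Sum>x\<in>S. ev \<rho> (F x))"
  by (induction S rule: infinite_finite_induct) simp_all

lemma ev_single_mult:
  "ev \<rho> (Poly_Mapping.single m c * Poly_Mapping.single m' c') =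
   ev \<rho> (Poly_Mapping.single m c) * ev \<rho> (Poly_Mapping.single m' c')"
proof -
  let ?S = "Poly_Mapping.keys m \<union> Poly_Mapping.keys m'"
  have P: "(\<Prod>v\<in>Poly_Mapping.keys u. \<rho> v ^ Poly_Mapping.lookup u v) =
      (\<Prod>v\<in>?S. \<rho> v ^ Poly_Mapping.lookup u v)" if "u \<in> {m, m', m + m'}" for u
    by (rule monomial_prod_superset) (use that Poly_Mapping.keys_add[of m m'] in auto)
  show ?thesis
    unfolding mult_single ev_single P[of m, simplified] P[of m', simplified] P[of "m + m'", simplified]
    by (simp add: lookup_add power_add prod.distrib)
qed

lemma ev_mult [simp]: "ev \<rho> (f * g) = ev \<rho> f * ev \<rho> g"
proof -
  have "f * g = (\<Sum>m\<in>Poly_Mapping.keys f. \<Sum>m'\<in>Poly_Mapping.keys g.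
      Poly_Mapping.single m (Poly_Mapping.lookup f m) *
      Poly_Mapping.single m' (Poly_Mapping.lookup g m'))"
    by (subst (1 2) cpoly_monomials[symmetric]) (rule sum_product)
  then have "ev \<rho> (f * g) = (\<Sum>m\<in>Poly_Mapping.keys f. ev \<rho> (Poly_Mapping.single m (Poly_Mapping.lookup f m))) *
     (\<Sum>m'\<in>Poly_Mapping.keys g. ev \<rho> (Poly_Mapping.single m' (Poly_Mapping.lookup g m')))"
    by (simp only: ev_sum ev_single_mult sum_product)
  then show ?thesis
    by (simp only: ev_sum[symmetric] cpoly_monomials)
qed

lemma ev_Const [simp]: "ev \<rho> (Const c) = c"
  by (simp add: Const_def ev_single)

lemma ev_one [simp]: "ev \<rho> 1 = 1"
  unfolding single_one[symmetric] ev_single by simp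

lemma ev_Var [simp]: "ev \<rho> (Var v) = \<rho> v"
  by (simp add: Var_def ev_single)

lemma ev_power [simp]: "ev \<rho> (f ^ j) = ev \<rho> f ^ j"
  by (induction j) simp_all

lemma ev_prod [simp]: "ev \<rho> (\<Prod>x\<in>S. F x) = (\<Prod>x\<in>S. ev \<rho> (F x))"
  by (induction S rule: infinite_finite_induct) simp_all

lemma ev_psubst [simp]: "ev \<rho> (psubst s f) = ev (\<lambda>v. ev \<rho> (s v)) f"
  by (simp add: psubst_def, simp add: ev_def)

lemma ev_cong:
  assumes "\<And>m. m \<in> Poly_Mapping.keys f \<Longrightarrow> Poly_Mapping.keys m \<subseteq> V" "\<And>v. v \<in> V \<Longrightarrow> \<rho> v = \<rho>' v"
  shows "ev \<rho> f = ev \<rho>' f"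
  unfolding ev_def using assms by (intro sum.cong prod.cong refl arg_cong2[where f = "(*)"]) (auto simp: subset_iff)

section \<open>Formal derivatives as derivatives along complex lines\<close>

lemma pderiv_var_add: "pderiv_var v (f + g) = pderiv_var v f + pderiv_var v g"
  by (rule poly_mapping_eqI) (simp add: lookup_pderiv_var lookup_add algebra_simps)

lemma pderiv_var_zero [simp]: "pderiv_var v 0 = 0"
  by (rule poly_mapping_eqI) (simp add: lookup_pderiv_var)

lemma pderiv_var_sum: "pderiv_var v (\<Sum>x\<in>S. F x) = (\<Sum>x\<in>S. pderiv_var v (F x))"
  by (induction S rule: infinite_finite_induct) (simp_all add: pderiv_var_add)

lemma pderiv_var_single:
  "pderiv_var v (Poly_Mapping.single m c) =
    Poly_Mapping.single (m - Poly_Mapping.single v 1) (of_nat (Poly_Mapping.lookup m v) * c)"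
  by (cases "c = 0") (simp_all add: pderiv_var_def)

lemma DERIV_prod_line:
  fixes a e :: "'b \<Rightarrow> complex"
  shows "((\<lambda>t. \<Prod>v\<in>V. (a v + t * e v) ^ j v) has_field_derivative
     (\<Sum>v\<in>V. (of_nat (j v) * e v * a v ^ (j v - 1)) * (\<Prod>w\<in>V - {v}. a w ^ j w))) (at 0)"
proof -
  have "((\<lambda>t. (a v + t * e v) ^ j v) has_field_derivative of_nat (j v) * e v * a v ^ (j v - 1)) (at 0)" for v
    by (auto intro!: derivative_eq_intros)
  from has_field_derivative_prod[where A = V, OF this]
  show ?thesis by simp
qed

lemma ev_single_deriv:
  assumes V: "finite V" "Poly_Mapping.keys m \<subseteq> V"
  shows "((\<lambda>t. ev (\<lambda>v. \<rho> v + t * e v) (Poly_Mapping.single m c)) has_field_derivative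
     (\<Sum>v\<in>V. e v * ev \<rho> (pderiv_var v (Poly_Mapping.single m c)))) (at 0)"
proof -
  \<comment> \<open>Lowering the exponent of \<open>v\<close> alters only the factor at
    \<open>v\<close>. If \<open>v\<close> does not occur in \<open>m\<close>, its exponent zero as a
    coefficient makes both sides vanish.\<close>
  have d: "e v * ev \<rho> (pderiv_var v (Poly_Mapping.single m c)) =
     c * ((of_nat (Poly_Mapping.lookup m v) * e v * \<rho> v ^ (Poly_Mapping.lookup m v - 1)) *
       (\<Prod>w\<in>V - {v}. \<rho> w ^ Poly_Mapping.lookup m w))" if "v \<in> V" for v
  proof -
    let ?m = "m - Poly_Mapping.single v (1::nat)"
    have "Poly_Mapping.keys ?m \<subseteq> V"
      using V by (auto simp: in_keys_iff lookup_minus)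
    then have "(\<Prod>w\<in>Poly_Mapping.keys ?m. \<rho> w ^ Poly_Mapping.lookup ?m w) =
        (\<Prod>w\<in>V. \<rho> w ^ Poly_Mapping.lookup ?m w)"
      by (intro monomial_prod_superset V)
    also have "\<dots> = \<rho> v ^ Poly_Mapping.lookup ?m v * (\<Prod>w\<in>V - {v}. \<rho> w ^ Poly_Mapping.lookup ?m w)"
      by (rule prod.remove) (use V that in auto)
    also have "(\<Prod>w\<in>V - {v}. \<rho> w ^ Poly_Mapping.lookup ?m w) =
        (\<Prod>w\<in>V - {v}. \<rho> w ^ Poly_Mapping.lookup m w)"
      by (rule prod.cong) (auto simp: lookup_minus lookup_single)
    finally show ?thesis
      by (simp add: pderiv_var_single ev_single lookup_minus)
  qed
  have "((\<lambda>t. c * (\<Prod>v\<in>V. (\<rho> v + t * e v) ^ Poly_Mapping.lookup m v)) has_field_derivative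
     c * (\<Sum>v\<in>V. (of_nat (Poly_Mapping.lookup m v) * e v * \<rho> v ^ (Poly_Mapping.lookup m v - 1)) *
       (\<Prod>w\<in>V - {v}. \<rho> w ^ Poly_Mapping.lookup m w))) (at 0)"
    by (intro DERIV_cmult DERIV_prod_line)
  then show ?thesis
    by (simp add: d ev_single[of _ m] monomial_prod_superset[OF V] sum_distrib_left cong: sum.cong
      del: mult_eq_0_iff mult_cancel_left)
qed

text \<open>Chain rule along an affine line. Together with uniqueness of derivatives it turns
  identities of polynomial functions into identities of formal partial derivatives.\<close>

lemma ev_line_deriv:
  assumes V: "finite V" "\<And>m. m \<in> Poly_Mapping.keys f \<Longrightarrow> Poly_Mapping.keys m \<subseteq> V"
  shows "((\<lambda>t. ev (\<lambda>v. \<rho> v + t * e v) f) has_field_derivative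
     (\<Sum>v\<in>V. e v * ev \<rho> (pderiv_var v f))) (at 0)"
proof -
  let ?s = "\<lambda>m. Poly_Mapping.single m (Poly_Mapping.lookup f m)"
  have "((\<lambda>t. \<Sum>m\<in>Poly_Mapping.keys f. ev (\<lambda>v. \<rho> v + t * e v) (?s m)) has_field_derivative
     (\<Sum>m\<in>Poly_Mapping.keys f. \<Sum>v\<in>V. e v * ev \<rho> (pderiv_var v (?s m)))) (at 0)"
    by (intro DERIV_sum ev_single_deriv V)
  moreover have "(\<Sum>m\<in>Poly_Mapping.keys f. \<Sum>v\<in>V. e v * ev \<rho> (pderiv_var v (?s m))) =
     (\<Sum>v\<in>V. e v * ev \<rho> (pderiv_var v f))"
    by (subst (2) cpoly_monomials[symmetric], subst sum.swap)
      (simp add: pderiv_var_sum sum_distrib_left)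
  moreover have "(\<Sum>m\<in>Poly_Mapping.keys f. ev (\<lambda>v. \<rho> v + t * e v) (?s m)) = ev (\<lambda>v. \<rho> v + t * e v) f" for t
    by (subst ev_sum[symmetric], subst cpoly_monomials) (rule refl)
  ultimately show ?thesis by simp
qed

lemma ev_partial_deriv:
  "((\<lambda>t. ev (\<rho>(v := \<rho> v + t)) f) has_field_derivative ev \<rho> (pderiv_var v f)) (at 0)"
proof -
  let ?V = "insert v (\<Union>m\<in>Poly_Mapping.keys f. Poly_Mapping.keys m)"
  have "((\<lambda>t. ev (\<lambda>w. \<rho> w + t * of_bool (w = v)) f) has_field_derivative
     (\<Sum>w\<in>?V. of_bool (w = v) * ev \<rho> (pderiv_var w f))) (at 0)"
    by (rule ev_line_deriv) auto
  moreover have "(\<Sum>w\<in>?V. of_bool (w = v) * ev \<rho> (pderiv_var w f)) = ev \<rho> (pderiv_var v f)"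
    by (subst sum.remove[of _ v]) auto
  moreover have "(\<lambda>w. \<rho> w + t * of_bool (w = v)) = \<rho>(v := \<rho> v + t)" for t
    by auto
  ultimately show ?thesis by (simp only:)
qed

text \<open>A polynomial function that vanishes identically has vanishing partial derivatives, so all
  Taylor coefficients at the origin are zero.\<close>

lemma lookup_eq_0_if_ev_eq_0:
  assumes "\<And>\<rho>. ev \<rho> f = 0"
  shows "Poly_Mapping.lookup f m = 0"
  using assms
\<comment> \<open>Induction on the total degree of \<open>m\<close>, with \<open>f\<close> arbitrary
  because the step replaces \<open>f\<close> by a partial derivative.\<close>
proof (induction "\<Sum>v\<in>Poly_Mapping.keys m. Poly_Mapping.lookup m v" arbitrary: m f)
  case 0
  then have m: "m = 0"
    by (intro poly_mapping_eqI) (metis finite_keys in_keys_iff lookup_zero sum_eq_0_iff)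
  \<comment> \<open>At the origin only the constant monomial survives; every other one contains
    \<open>0\<close> to a positive power.\<close>
  have "ev (\<lambda>_. 0) f = (\<Sum>u\<in>insert 0 (Poly_Mapping.keys f). if u = 0 then Poly_Mapping.lookup f 0 else 0)"
  proof (subst ev_superset[of "insert 0 (Poly_Mapping.keys f)"], goal_cases)
    case 3
    show ?case
    proof (intro sum.cong refl)
      fix u :: "mvar \<Rightarrow>\<^sub>0 nat"
      show "Poly_Mapping.lookup f u * (\<Prod>v\<in>Poly_Mapping.keys u. 0 ^ Poly_Mapping.lookup u v) =
          (if u = 0 then Poly_Mapping.lookup f 0 else 0)"
      proof (cases "u = 0")
        case False
        then obtain v where v: "v \<in> Poly_Mapping.keys u" by fastforce
        then have "(\<Prod>v\<in>Poly_Mapping.keys u. (0::complex) ^ Poly_Mapping.lookup u v) = 0"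
          by (intro prod_zero) (auto simp: in_keys_iff zero_power)
        with False show ?thesis by simp
      qed simp
    qed
  qed auto
  then have "ev (\<lambda>_. 0) f = Poly_Mapping.lookup f 0" by simp
  with 0 m show ?case by simp
next
  case (Suc j)
  then obtain v where v: "v \<in> Poly_Mapping.keys m"
    by (metis empty_iff equals0I sum.empty nat.distinct(1))
  let ?m = "m - Poly_Mapping.single v (1::nat)"
  have m: "m = ?m + Poly_Mapping.single v 1"
    using v by (intro poly_mapping_eqI)
      (auto simp: lookup_add lookup_minus lookup_single when_def in_keys_iff)
  have "(\<Sum>w\<in>Poly_Mapping.keys m. Poly_Mapping.lookup m w) =
      Poly_Mapping.lookup m v + (\<Sum>w\<in>Poly_Mapping.keys m - {v}. Poly_Mapping.lookup m w)"
    by (rule sum.remove) (use v in auto)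
  moreover have "(\<Sum>w\<in>Poly_Mapping.keys ?m. Poly_Mapping.lookup ?m w) = (\<Sum>w\<in>Poly_Mapping.keys m. Poly_Mapping.lookup ?m w)"
    by (rule sum.mono_neutral_left) (auto simp: in_keys_iff lookup_minus)
  moreover have "\<dots> = Poly_Mapping.lookup ?m v + (\<Sum>w\<in>Poly_Mapping.keys m - {v}. Poly_Mapping.lookup ?m w)"
    by (rule sum.remove) (use v in auto)
  moreover have "(\<Sum>w\<in>Poly_Mapping.keys m - {v}. Poly_Mapping.lookup ?m w) =
      (\<Sum>w\<in>Poly_Mapping.keys m - {v}. Poly_Mapping.lookup m w)"
    by (rule sum.cong) (auto simp: lookup_minus lookup_single)
  moreover have "Poly_Mapping.lookup m v \<noteq> 0" using v by (simp add: in_keys_iff)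
  ultimately have "j = (\<Sum>w\<in>Poly_Mapping.keys ?m. Poly_Mapping.lookup ?m w)"
    using Suc.hyps(2) by (simp add: lookup_minus)
  moreover have "ev \<rho> (pderiv_var v f) = 0" for \<rho>
    using DERIV_unique[OF ev_partial_deriv[of \<rho> v f], of 0] by (simp add: Suc.prems)
  ultimately have "Poly_Mapping.lookup (pderiv_var v f) ?m = 0"
    by (rule Suc.hyps(1))
  then show ?case
    by (subst m) (simp add: lookup_pderiv_var del: of_nat_Suc of_nat_add)
qed

text \<open>The Taylor argument applied to \<open>f - g\<close>. Later identities in the polynomial
  ring, such as the Leibniz rule, are checked value by value through this lemma.\<close>

lemma ev_inject:
  assumes "\<And>\<rho>. ev \<rho> f = ev \<rho> g"
  shows "f = g"
proof (rule poly_mapping_eqI)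
  fix m
  have "ev \<rho> (f - g) = 0" for \<rho>
    using ev_add[of \<rho> "f - g" g] assms by simp
  from lookup_eq_0_if_ev_eq_0[OF this, of m]
  show "Poly_Mapping.lookup f m = Poly_Mapping.lookup g m"
    by (simp add: lookup_minus)
qed

lemma Const_0 [simp]: "Const 0 = 0"
  and Const_1 [simp]: "Const 1 = 1"
  by (rule ev_inject; simp)+

lemma psubst_add: "psubst s (f + g) = psubst s f + psubst s g"
  and psubst_mult: "psubst s (f * g) = psubst s f * psubst s g"
  and psubst_sum: "psubst s (\<Sum>x\<in>S. F x) = (\<Sum>x\<in>S. psubst s (F x))"
  and psubst_Const [simp]: "psubst s (Const c) = Const c"
  and psubst_Var [simp]: "psubst s (Var v) = s v"
  and psubst_0 [simp]: "psubst s 0 = 0"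
  by (rule ev_inject; simp)+

lemma pderiv_var_mult:
  "pderiv_var v (f * g) = pderiv_var v f * g + f * pderiv_var v g"
proof (rule ev_inject)
  fix \<rho>
  have "((\<lambda>t. ev (\<rho>(v := \<rho> v + t)) f * ev (\<rho>(v := \<rho> v + t)) g) has_field_derivative
     ev \<rho> (pderiv_var v f) * ev \<rho> g + ev \<rho> f * ev \<rho> (pderiv_var v g)) (at 0)"
    by (auto intro!: derivative_eq_intros ev_partial_deriv)
  from DERIV_unique[OF this, of "ev \<rho> (pderiv_var v (f * g))"] ev_partial_deriv[of \<rho> v "f * g"]
  show "ev \<rho> (pderiv_var v (f * g)) = ev \<rho> (pderiv_var v f * g + f * pderiv_var v g)"
    by simp
qed

lemma pderiv_var_Var: "pderiv_var v (Var w) = (if v = w then 1 else 0)"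
  by (auto simp: Var_def pderiv_var_single lookup_single when_def single_one[symmetric] single_zero
    simp del: single_one)

lemma pderiv_var_Const [simp]: "pderiv_var v (Const c) = 0"
  by (simp add: Const_def pderiv_var_single)

lemma pderiv_var_Const_mult: "pderiv_var v (Const c * f) = Const c * pderiv_var v f"
  by (simp add: pderiv_var_mult)

text \<open>By assumption, moving \<open>w\<close> moves the value of \<open>s v\<close> at unit
  speed and that of no other \<open>s u\<close>, so the chain rule has a single term with factor
  1.\<close>

lemma pderiv_var_psubst_shift:
  assumes "\<And>\<rho> t u. ev (\<rho>(w := \<rho> w + t)) (s u) = ev \<rho> (s u) + (if u = v then t else 0)"
  shows "pderiv_var w (psubst s f) = psubst s (pderiv_var v f)"
proof (rule ev_inject)
  fix \<rho>
  let ?\<rho> = "\<lambda>u. ev \<rho> (s u)"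
  have "(\<lambda>u. ev (\<rho>(w := \<rho> w + t)) (s u)) = ?\<rho>(v := ?\<rho> v + t)" for t
    using assms by auto
  then have "((\<lambda>t. ev (?\<rho>(v := ?\<rho> v + t)) f) has_field_derivative ev \<rho> (pderiv_var w (psubst s f))) (at 0)"
    using ev_partial_deriv[of \<rho> w "psubst s f"] by (simp only: ev_psubst)
  from DERIV_unique[OF this ev_partial_deriv]
  show "ev \<rho> (pderiv_var w (psubst s f)) = ev \<rho> (psubst s (pderiv_var v f))" by simp
qed

section \<open>Polynomials in the entries of \<open>X\<close> and \<open>A\<close>\<close>

lemma finite_mvars [simp]: "finite (mvars n N)"
proof -
  have "mvars n N = case_prod XV ` ({..<N} \<times> {..<N}) \<union> case_prod AV ` ({..<n} \<times> {..<N})"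
    unfolding mvars_def by auto
  then show ?thesis by simp
qed

lemma XV_in_mvars [simp]: "XV i j \<in> mvars n N \<longleftrightarrow> i < N \<and> j < N"
  and AV_in_mvars [simp]: "AV a i \<in> mvars n N \<longleftrightarrow> a < n \<and> i < N"
  by (auto simp: mvars_def)

lemma sum_mvars:
  "(\<Sum>v\<in>mvars n N. F v) = (\<Sum>i<N. \<Sum>j<N. F (XV i j)) + (\<Sum>a<n. \<Sum>i<N. F (AV a i))"
proof -
  have "mvars n N = case_prod XV ` ({..<N} \<times> {..<N}) \<union> case_prod AV ` ({..<n} \<times> {..<N})"
    unfolding mvars_def by auto
  then have "(\<Sum>v\<in>mvars n N. F v) = (\<Sum>v\<in>case_prod XV ` ({..<N} \<times> {..<N}). F v) +
      (\<Sum>v\<in>case_prod AV ` ({..<n} \<times> {..<N}). F v)"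
    by (simp, subst sum.union_disjoint) auto
  then show ?thesis
    by (subst (asm) (1 2) sum.reindex)
      (auto simp: inj_on_def sum.cartesian_product case_prod_unfold)
qed

lemma polyring_0 [simp]: "0 \<in> polyring n N"
  by (simp add: polyring_def)

lemma polyring_add [simp]: "f \<in> polyring n N \<Longrightarrow> g \<in> polyring n N \<Longrightarrow> f + g \<in> polyring n N"
  using Poly_Mapping.keys_add[of f g] by (fastforce simp: polyring_def)

lemma polyring_sum [simp]: "(\<And>x. x \<in> S \<Longrightarrow> F x \<in> polyring n N) \<Longrightarrow> (\<Sum>x\<in>S. F x) \<in> polyring n N"
  by (induction S rule: infinite_finite_induct) simp_all

lemma polyring_mult [simp]:
  assumes "f \<in> polyring n N" "g \<in> polyring n N"
  shows "f * g \<in> polyring n N"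
  unfolding polyring_def
proof safe
  fix m v assume "m \<in> Poly_Mapping.keys (f * g)" and v: "v \<in> Poly_Mapping.keys m"
  then obtain a b where m: "m = a + b" "a \<in> Poly_Mapping.keys f" "b \<in> Poly_Mapping.keys g"
    using keys_mult[of f g] by auto
  then show "v \<in> mvars n N"
    using v assms Poly_Mapping.keys_add[of a b] by (fastforce simp: polyring_def)
qed

lemma polyring_Const [simp]: "Const c \<in> polyring n N"
  by (simp add: polyring_def Const_def)

lemma polyring_Var [simp]: "v \<in> mvars n N \<Longrightarrow> Var v \<in> polyring n N"
  by (simp add: polyring_def Var_def)

lemma polyring_one [simp]: "1 \<in> polyring n N"
  using polyring_Const[of 1] by simp

lemma polyring_power [simp]: "f \<in> polyring n N \<Longrightarrow> f ^ j \<in> polyring n N"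
  by (induction j) simp_all

lemma polyring_prod [simp]: "(\<And>x. x \<in> S \<Longrightarrow> F x \<in> polyring n N) \<Longrightarrow> (\<Prod>x\<in>S. F x) \<in> polyring n N"
  by (induction S rule: infinite_finite_induct) simp_all

lemma polyring_pderiv_var [simp]:
  assumes "f \<in> polyring n N"
  shows "pderiv_var v f \<in> polyring n N"
  unfolding polyring_def
proof safe
  fix m w assume "m \<in> Poly_Mapping.keys (pderiv_var v f)" and w: "w \<in> Poly_Mapping.keys m"
  then have "m + Poly_Mapping.single v 1 \<in> Poly_Mapping.keys f"
    by (auto simp: in_keys_iff lookup_pderiv_var)
  moreover have "w \<in> Poly_Mapping.keys (m + Poly_Mapping.single v 1)"
    using w by (auto simp: in_keys_iff lookup_add)
  ultimately show "w \<in> mvars n N"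
    using assms by (auto simp: polyring_def)
qed

lemma polyring_psubst:
  assumes "f \<in> polyring n' N'" "\<And>v. v \<in> mvars n' N' \<Longrightarrow> s v \<in> polyring n N"
  shows "psubst s f \<in> polyring n N"
  unfolding psubst_def
proof (intro polyring_sum polyring_mult polyring_Const polyring_prod polyring_power)
  fix m v assume "m \<in> Poly_Mapping.keys f" "v \<in> Poly_Mapping.keys m"
  then have "v \<in> mvars n' N'" using assms(1) by (auto simp: polyring_def)
  then show "s v \<in> polyring n N" by (rule assms(2))
qed

lemma ev_polyring_cong:
  assumes "f \<in> polyring n N" "\<And>v. v \<in> mvars n N \<Longrightarrow> \<rho> v = \<rho>' v"
  shows "ev \<rho> f = ev \<rho>' f"
  by (rule ev_cong[of f "mvars n N"]) (use assms in \<open>auto simp: polyring_def\<close>)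

lemma ev_polyring_line_deriv:
  assumes "f \<in> polyring n N"
  shows "((\<lambda>t. ev (\<lambda>v. \<rho> v + t * e v) f) has_field_derivative
     (\<Sum>v\<in>mvars n N. e v * ev \<rho> (pderiv_var v f))) (at 0)"
  by (rule ev_line_deriv) (use assms in \<open>auto simp: polyring_def\<close>)

section \<open>Equivariance\<close>

text \<open>Replacing \<open>X\<close> by \<open>Z g\<close> and \<open>A\<close> by \<open>C g\<close> turns the condition on \<open>f\<close> into
  \<open>det(g)\<^sup>k f(g Z, C) = f(Z g, C g)\<close>, both sides of which are linear substitutions without inverses.\<close>

fun lact :: "nat \<Rightarrow> complex mat \<Rightarrow> (mvar \<Rightarrow> complex) \<Rightarrow> mvar \<Rightarrow> complex" where
  "lact N g \<rho> (XV i j) = (\<Sum>l<N. g $$ (i, l) * \<rho> (XV l j))"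
| "lact N g \<rho> (AV a i) = \<rho> (AV a i)"

fun ract :: "nat \<Rightarrow> complex mat \<Rightarrow> (mvar \<Rightarrow> complex) \<Rightarrow> mvar \<Rightarrow> complex" where
  "ract N g \<rho> (XV i j) = (\<Sum>l<N. \<rho> (XV i l) * g $$ (l, j))"
| "ract N g \<rho> (AV a j) = (\<Sum>l<N. \<rho> (AV a l) * g $$ (l, j))"

lemma obtain_inverse_mat:
  fixes g :: "complex mat"
  assumes g: "g \<in> carrier_mat N N" "det g \<noteq> 0"
  obtains h where "h \<in> carrier_mat N N" "g * h = 1\<^sub>m N" "h * g = 1\<^sub>m N"
proof -
  have "g \<in> Units (ring_mat TYPE(complex) N ())"
    using det_non_zero_imp_unit[OF g] .
  then show ?thesis
    using that by (auto simp: Units_def ring_mat_def)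
qed

lemma lact_entry:
  assumes "g \<in> carrier_mat N N" "Z \<in> carrier_mat N N" "v \<in> mvars n N"
  shows "entry (g * Z) C v = lact N g (entry Z C) v"
  using assms by (cases v) (auto simp: scalar_prod_def lessThan_atLeast0)

lemma ract_entry:
  assumes "g \<in> carrier_mat N N" "Z \<in> carrier_mat N N" "C \<in> carrier_mat n N" "v \<in> mvars n N"
  shows "entry (Z * g) (C * g) v = ract N g (entry Z C) v"
  using assms by (cases v) (auto simp: scalar_prod_def lessThan_atLeast0)

lemma lact_cong:
  assumes "\<And>v. v \<in> mvars n N \<Longrightarrow> \<rho> v = \<rho>' v" "v \<in> mvars n N"
  shows "lact N g \<rho> v = lact N g \<rho>' v"
  using assms by (cases v) (auto intro!: sum.cong)

lemma ract_cong:
  assumes "\<And>v. v \<in> mvars n N \<Longrightarrow> \<rho> v = \<rho>' v" "v \<in> mvars n N"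
  shows "ract N g \<rho> v = ract N g \<rho>' v"
  using assms by (cases v) (auto intro!: sum.cong)

lemma Hspace_polyring: "f \<in> Hspace n k N \<Longrightarrow> f \<in> polyring n N"
  by (simp add: Hspace_def)

lemma Hspace_twisted:
  assumes f: "f \<in> Hspace n k N" and g: "g \<in> carrier_mat N N" "det g \<noteq> 0"
  shows "det g ^ k * ev (lact N g \<rho>) f = ev (ract N g \<rho>) f"
proof -
  obtain h where h: "h \<in> carrier_mat N N" "g * h = 1\<^sub>m N" "h * g = 1\<^sub>m N"
    by (rule obtain_inverse_mat[OF g])
  define Z where "Z = mat N N (\<lambda>(i, j). \<rho> (XV i j))"
  define C where "C = mat n N (\<lambda>(a, i). \<rho> (AV a i))"
  have Z: "Z \<in> carrier_mat N N" and C: "C \<in> carrier_mat n N" by (simp_all add: Z_def C_def)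
  have Zg: "Z * g \<in> carrier_mat N N" and Cg: "C * g \<in> carrier_mat n N" using Z C g by auto
  have \<rho>: "entry Z C v = \<rho> v" if "v \<in> mvars n N" for v
    using that by (cases v) (auto simp: Z_def C_def)
  have fp: "f \<in> polyring n N" using f by (rule Hspace_polyring)
  have inv: "inverts_mat g h" "inverts_mat h g" using g h by (auto simp: inverts_mat_def)
  have "eval_at f (g * (Z * g) * h) (C * g * h) = det g powi (- int k) * eval_at f (Z * g) (C * g)"
    using f g h Zg Cg inv unfolding Hspace_def by blast
  moreover have "g * (Z * g) * h = g * Z"
    using g h Z Zg by (simp add: assoc_mult_mat[of _ N N _ N _ N])
  moreover have "C * g * h = C"
    using g h C by (simp add: assoc_mult_mat[of _ n N _ N _ N])
  ultimately have "ev (entry (g * Z) C) f = det g powi (- int k) * ev (entry (Z * g) (C * g)) f"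
    by (simp add: eval_at_eq_ev)
  moreover have "ev (entry (g * Z) C) f = ev (lact N g \<rho>) f"
    by (rule ev_polyring_cong[OF fp], rule trans[OF lact_entry[OF g(1) Z] lact_cong[OF \<rho>]])
  moreover have "ev (entry (Z * g) (C * g)) f = ev (ract N g \<rho>) f"
    by (rule ev_polyring_cong[OF fp], rule trans[OF ract_entry[OF g(1) Z C] ract_cong[OF \<rho>]])
  ultimately show ?thesis
    using g(2) by (simp add: power_int_minus field_simps)
qed

text \<open>Every pair \<open>(X, A)\<close> is \<open>(Z g, C g)\<close> with
  \<open>Z = X h\<close>, \<open>C = A h\<close> and \<open>h\<close> inverse to \<open>g\<close>,
  so the inverse-free condition is equivalent to membership.\<close>

lemma HspaceI:
  assumes f: "f \<in> polyring n N"
    and tw: "\<And>g \<rho>. g \<in> carrier_mat N N \<Longrightarrow> det g \<noteq> 0 \<Longrightarrow>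
      det g ^ k * ev (lact N g \<rho>) f = ev (ract N g \<rho>) f"
  shows "f \<in> Hspace n k N"
  unfolding Hspace_def mem_Collect_eq
proof (intro conjI ballI impI f)
  fix g h X A :: "complex mat"
  assume g: "g \<in> carrier_mat N N" and h: "h \<in> carrier_mat N N"
    and inv: "inverts_mat g h \<and> inverts_mat h g"
    and X: "X \<in> carrier_mat N N" and A: "A \<in> carrier_mat n N"
  have gh: "g * h = 1\<^sub>m N" "h * g = 1\<^sub>m N" using inv g h by (auto simp: inverts_mat_def)
  have "det g * det h = 1" using det_mult[OF g h] gh by simp
  then have dg: "det g \<noteq> 0" by auto
  have Z: "X * h \<in> carrier_mat N N" and C: "A * h \<in> carrier_mat n N" using X A h by auto
  have *: "X * h * g = X" "A * h * g = A" "g * (X * h) = g * X * h"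
    using g h X A gh by (simp_all add: assoc_mult_mat[of _ N N _ N _ N] assoc_mult_mat[of _ n N _ N _ N])
  have "ev (entry (g * (X * h)) (A * h)) f = ev (lact N g (entry (X * h) (A * h))) f"
    by (rule ev_polyring_cong[OF f]) (rule lact_entry[OF g Z])
  moreover have "ev (entry (X * h * g) (A * h * g)) f = ev (ract N g (entry (X * h) (A * h))) f"
    by (rule ev_polyring_cong[OF f]) (rule ract_entry[OF g Z C])
  ultimately have "det g ^ k * eval_at f (g * X * h) (A * h) = eval_at f X A"
    using tw[OF g dg, of "entry (X * h) (A * h)"] by (simp add: * eval_at_eq_ev)
  then show "eval_at f (g * X * h) (A * h) = det g powi (- int k) * eval_at f X A"
    using dg by (simp add: power_int_minus field_simps)
qed

lemma Hspace_zero: "0 \<in> Hspace n k N"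
  by (rule HspaceI) simp_all

lemma Hspace_add: "f \<in> Hspace n k N \<Longrightarrow> g \<in> Hspace n k N \<Longrightarrow> f + g \<in> Hspace n k N"
  by (rule HspaceI) (simp_all add: Hspace_polyring Hspace_twisted algebra_simps)

lemma Hspace_Const_mult:
  assumes "f \<in> Hspace n k N"
  shows "Const c * f \<in> Hspace n k N"
proof (rule HspaceI)
  fix g :: "complex mat" and \<rho>
  assume "g \<in> carrier_mat N N" "det g \<noteq> 0"
  from Hspace_twisted[OF assms this, of \<rho>]
  show "det g ^ k * ev (lact N g \<rho>) (Const c * f) = ev (ract N g \<rho>) (Const c * f)"
    by (simp add: mult.left_commute)
qed (use assms in \<open>simp add: Hspace_polyring\<close>)

lemma Hspace_sum: "(\<And>x. x \<in> S \<Longrightarrow> F x \<in> Hspace n k N) \<Longrightarrow> (\<Sum>x\<in>S. F x) \<in> Hspace n k N"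
  by (induction S rule: infinite_finite_induct) (simp_all add: Hspace_zero Hspace_add)

section \<open>Equivariance differentiated with respect to the point\<close>

lemma lact_line: "lact N g (\<lambda>v. \<rho> v + t * e v) = (\<lambda>v. lact N g \<rho> v + t * lact N g e v)"
proof
  fix v show "lact N g (\<lambda>v. \<rho> v + t * e v) v = lact N g \<rho> v + t * lact N g e v"
    by (cases v) (simp_all add: algebra_simps sum.distrib sum_distrib_left)
qed

lemma ract_line: "ract N g (\<lambda>v. \<rho> v + t * e v) = (\<lambda>v. ract N g \<rho> v + t * ract N g e v)"
proof
  fix v show "ract N g (\<lambda>v. \<rho> v + t * e v) v = ract N g \<rho> v + t * ract N g e v"
    by (cases v) (simp_all add: algebra_simps sum.distrib sum_distrib_left)
qed

text \<open>The defining representation of \<open>GL\<^sub>N\<close> in place of the trivial one.\<close>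

definition eqvec :: "nat \<Rightarrow> nat \<Rightarrow> nat \<Rightarrow> (nat \<Rightarrow> cpoly) \<Rightarrow> bool" where
  "eqvec n k N F \<longleftrightarrow> (\<forall>p<N. F p \<in> polyring n N) \<and>
     (\<forall>g\<in>carrier_mat N N. det g \<noteq> 0 \<longrightarrow> (\<forall>\<rho>. \<forall>p<N.
        det g ^ k * ev (lact N g \<rho>) (F p) = (\<Sum>q<N. g $$ (p, q) * ev (ract N g \<rho>) (F q))))"

lemma eqvec_polyring: "eqvec n k N F \<Longrightarrow> p < N \<Longrightarrow> F p \<in> polyring n N"
  by (simp add: eqvec_def)

lemma eqvec_twisted:
  "eqvec n k N F \<Longrightarrow> g \<in> carrier_mat N N \<Longrightarrow> det g \<noteq> 0 \<Longrightarrow> p < N \<Longrightarrow>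
    det g ^ k * ev (lact N g \<rho>) (F p) = (\<Sum>q<N. g $$ (p, q) * ev (ract N g \<rho>) (F q))"
  by (simp add: eqvec_def)

lemma eqvec_cong:
  assumes "\<And>p. p < N \<Longrightarrow> F p = G p"
  shows "eqvec n k N F \<longleftrightarrow> eqvec n k N G"
  using assms by (simp add: eqvec_def)

text \<open>The group element stays fixed while the point moves in the direction \<open>e\<close>.
  Both actions are linear, so the direction is transformed by the same action as the point.\<close>

lemma Hspace_line:
  assumes f: "f \<in> Hspace n k N" and g: "g \<in> carrier_mat N N" "det g \<noteq> 0"
  shows "det g ^ k * (\<Sum>v\<in>mvars n N. lact N g e v * ev (lact N g \<rho>) (pderiv_var v f)) =
    (\<Sum>v\<in>mvars n N. ract N g e v * ev (ract N g \<rho>) (pderiv_var v f))"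
proof -
  note fp = Hspace_polyring[OF f]
  have 1: "((\<lambda>t. det g ^ k * ev (lact N g (\<lambda>v. \<rho> v + t * e v)) f) has_field_derivative
    det g ^ k * (\<Sum>v\<in>mvars n N. lact N g e v * ev (lact N g \<rho>) (pderiv_var v f))) (at 0)"
    unfolding lact_line by (intro DERIV_cmult ev_polyring_line_deriv fp)
  have 2: "((\<lambda>t. ev (ract N g (\<lambda>v. \<rho> v + t * e v)) f) has_field_derivative
    (\<Sum>v\<in>mvars n N. ract N g e v * ev (ract N g \<rho>) (pderiv_var v f))) (at 0)"
    unfolding ract_line by (intro ev_polyring_line_deriv fp)
  show ?thesis
    using DERIV_unique[OF 1[unfolded Hspace_twisted[OF f g]] 2] .
qed

lemma eqvec_line:
  assumes F: "eqvec n k N F" and g: "g \<in> carrier_mat N N" "det g \<noteq> 0" and p: "p < N"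
  shows "det g ^ k * (\<Sum>v\<in>mvars n N. lact N g e v * ev (lact N g \<rho>) (pderiv_var v (F p))) =
    (\<Sum>q<N. g $$ (p, q) * (\<Sum>v\<in>mvars n N. ract N g e v * ev (ract N g \<rho>) (pderiv_var v (F q))))"
proof -
  note fp = eqvec_polyring[OF F]
  have 1: "((\<lambda>t. det g ^ k * ev (lact N g (\<lambda>v. \<rho> v + t * e v)) (F p)) has_field_derivative
    det g ^ k * (\<Sum>v\<in>mvars n N. lact N g e v * ev (lact N g \<rho>) (pderiv_var v (F p)))) (at 0)"
    unfolding lact_line by (intro DERIV_cmult ev_polyring_line_deriv fp p)
  have 2: "((\<lambda>t. \<Sum>q<N. g $$ (p, q) * ev (ract N g (\<lambda>v. \<rho> v + t * e v)) (F q)) has_field_derivative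
    (\<Sum>q<N. g $$ (p, q) * (\<Sum>v\<in>mvars n N. ract N g e v * ev (ract N g \<rho>) (pderiv_var v (F q))))) (at 0)"
    unfolding ract_line by (intro DERIV_sum DERIV_cmult ev_polyring_line_deriv fp) auto
  show ?thesis
    using DERIV_unique[OF 1[unfolded eqvec_twisted[OF F g p]] 2] .
qed

lemma eqvec_Bop:
  assumes f: "f \<in> Hspace n k N" and b: "b < n"
  shows "eqvec n k N (\<lambda>i. Bop i b f)"
  unfolding eqvec_def
proof (intro conjI allI impI ballI)
  fix p assume "p < N"
  then show "Bop p b f \<in> polyring n N"
    using Hspace_polyring[OF f] by (simp add: Bop_def)
next
  fix g :: "complex mat" and \<rho> p
  assume g: "g \<in> carrier_mat N N" "det g \<noteq> 0" and p: "p < N"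
  \<comment> \<open>Only \<open>A^b_p\<close> moves. Left multiplication does not touch
    \<open>A\<close>, while right multiplication spreads the move over row \<open>b\<close> of
    \<open>A\<close> with the coefficients of row \<open>p\<close> of \<open>g\<close>.\<close>
  let ?e = "\<lambda>v. of_bool (v = AV b p) :: complex"
  have "ract N g ?e (AV a j) = of_bool (a = b) * g $$ (p, j)" for a j
  proof -
    have "ract N g ?e (AV a j) = (\<Sum>l<N. if l = p then of_bool (a = b) * g $$ (p, j) else 0)"
      unfolding ract.simps by (rule sum.cong) auto
    with p show ?thesis by (simp only: sum.delta finite_lessThan lessThan_iff if_True)
  qed
  then have *: "ract N g ?e (AV a j) * y = (if a = b then g $$ (p, j) else 0) * y" for a j y
    by simp
  have **: "lact N g ?e (AV a j) * y = (if j = p then if a = b then y else 0 else 0)" for a j y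
    by simp
  have X: "lact N g ?e (XV i j) = 0" "ract N g ?e (XV i j) = 0" for i j
    by simp_all
  have A: "(\<Sum>a<n. \<Sum>j<N. (if a = b then F j else 0) * y a j) = (\<Sum>j<N. F j * y b j)" 
    for F :: "nat \<Rightarrow> complex" and y
  proof -
    have "(\<Sum>a<n. \<Sum>j<N. (if a = b then F j else 0) * y a j) =
        (\<Sum>a<n. if a = b then \<Sum>j<N. F j * y a j else 0)"
      by (rule sum.cong) auto
    with b show ?thesis by simp
  qed
  from Hspace_line[OF f g, of ?e \<rho>]
  show "det g ^ k * ev (lact N g \<rho>) (Bop p b f) = (\<Sum>q<N. g $$ (p, q) * ev (ract N g \<rho>) (Bop q b f))"
    unfolding sum_mvars * ** X A Bop_def using b p
    by (simp only: sum.delta finite_lessThan lessThan_iff if_True mult_zero_left mult_zero_right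
        sum.neutral_const add_0_left)
qed

text \<open>Since \<open>Y^l_m\<close> is the derivative in \<open>X^m_l\<close>, this is the vector
  \<open>Y F\<close>. With \<open>Xmul\<close> for \<open>X G\<close> and \<open>Amul\<close> for
  \<open>A^a G\<close>, applying \<open>XY\<close> to a vector is \<open>Xmul\<close> after
  \<open>divvec\<close>.\<close>

definition divvec :: "nat \<Rightarrow> (nat \<Rightarrow> cpoly) \<Rightarrow> nat \<Rightarrow> cpoly" where
  "divvec N F l = (\<Sum>m<N. pderiv_var (XV m l) (F m))"

definition Xmul :: "nat \<Rightarrow> (nat \<Rightarrow> cpoly) \<Rightarrow> nat \<Rightarrow> cpoly" where
  "Xmul N G i = (\<Sum>l<N. Var (XV i l) * G l)"

definition Amul :: "nat \<Rightarrow> nat \<Rightarrow> (nat \<Rightarrow> cpoly) \<Rightarrow> cpoly" where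
  "Amul N a G = (\<Sum>i<N. Var (AV a i) * G i)"

text \<open>In matrix form the assumption \<open>eq\<close> reads \<open>D g^T x = y g^T\<close>, so
  \<open>D x\<close> is conjugate to \<open>y\<close> and the traces agree.\<close>

lemma trace_of_conjugation:
  fixes D :: complex and N :: nat
  assumes gh: "\<And>i p. i < N \<Longrightarrow> p < N \<Longrightarrow> (\<Sum>c<N. g i c * h c p) = of_bool (i = p)"
    and hg: "\<And>c q. c < N \<Longrightarrow> q < N \<Longrightarrow> (\<Sum>p<N. h c p * g p q) = of_bool (c = q)"
    and eq: "\<And>c p. c < N \<Longrightarrow> p < N \<Longrightarrow> D * (\<Sum>i<N. g i c * x i p) = (\<Sum>q<N. g p q * y c q)"
  shows "D * (\<Sum>p<N. x p p) = (\<Sum>q<N. y q q)"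
proof -
  have "D * (\<Sum>p<N. x p p) = D * (\<Sum>p<N. \<Sum>i<N. (\<Sum>c<N. g i c * h c p) * x i p)"
  proof -
    have "(\<Sum>i<N. (\<Sum>c<N. g i c * h c p) * x i p) = x p p" if "p < N" for p
    proof -
      have "(\<Sum>i<N. (\<Sum>c<N. g i c * h c p) * x i p) = (\<Sum>i<N. if i = p then x i p else 0)"
        by (rule sum.cong) (use that in \<open>auto simp: gh\<close>)
      with that show ?thesis by simp
    qed
    then show ?thesis by simp
  qed
  also have "\<dots> = (\<Sum>p<N. \<Sum>i<N. \<Sum>c<N. h c p * (D * (g i c * x i p)))"
    unfolding sum_distrib_left sum_distrib_right by (simp only: mult_ac)
  also have "\<dots> = (\<Sum>p<N. \<Sum>c<N. \<Sum>i<N. h c p * (D * (g i c * x i p)))"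
    by (intro sum.cong refl sum.swap)
  also have "\<dots> = (\<Sum>p<N. \<Sum>c<N. h c p * (D * (\<Sum>i<N. g i c * x i p)))"
    by (simp add: sum_distrib_left)
  also have "\<dots> = (\<Sum>p<N. \<Sum>c<N. \<Sum>q<N. (h c p * g p q) * y c q)"
    by (intro sum.cong refl, subst eq) (auto simp: sum_distrib_left mult_ac)
  also have "\<dots> = (\<Sum>c<N. \<Sum>p<N. \<Sum>q<N. (h c p * g p q) * y c q)"
    by (rule sum.swap)
  also have "\<dots> = (\<Sum>c<N. \<Sum>q<N. \<Sum>p<N. (h c p * g p q) * y c q)"
    by (intro sum.cong refl sum.swap)
  also have "\<dots> = (\<Sum>c<N. \<Sum>q<N. (\<Sum>p<N. h c p * g p q) * y c q)"
    by (simp add: sum_distrib_right)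
  also have "\<dots> = (\<Sum>q<N. y q q)"
  proof (rule sum.cong[OF refl])
    fix c assume c: "c \<in> {..<N}"
    have "(\<Sum>q<N. (\<Sum>p<N. h c p * g p q) * y c q) = (\<Sum>q<N. if q = c then y c q else 0)"
      by (rule sum.cong) (use c in \<open>auto simp: hg\<close>)
    with c show "(\<Sum>q<N. (\<Sum>p<N. h c p * g p q) * y c q) = y c c" by simp
  qed
  finally show ?thesis .
qed

lemma mat_mult_eq_one_sum:
  assumes "g \<in> carrier_mat N N" "h \<in> carrier_mat N N" "g * h = 1\<^sub>m N" "i < N" "j < N"
  shows "(\<Sum>l<N. g $$ (i, l) * h $$ (l, j)) = of_bool (i = j)"
proof -
  have "(g * h) $$ (i, j) = (\<Sum>l<N. g $$ (i, l) * h $$ (l, j))"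
    using assms(1,2,4,5) by (simp add: scalar_prod_def lessThan_atLeast0)
  moreover have "(g * h) $$ (i, j) = of_bool (i = j)"
    unfolding assms(3) using assms(4,5) by simp
  ultimately show ?thesis by simp
qed

text \<open>For fixed \<open>l\<close> consider the matrix of derivatives of \<open>F p\<close> in
  \<open>X^i_l\<close>, with indices \<open>i\<close> and \<open>p\<close>. Differentiated
  equivariance makes it transform by conjugation, apart from the action of \<open>g\<close> on
  \<open>l\<close>. Component \<open>l\<close> of \<open>Y F\<close> is its trace, so the
  conjugation drops out.\<close>

lemma eqvec_divvec:
  assumes F: "eqvec n k N F"
  shows "eqvec n k N (divvec N F)"
  unfolding eqvec_def
proof (intro conjI allI impI ballI)
  fix p assume "p < N"
  then show "divvec N F p \<in> polyring n N"
    unfolding divvec_def by (intro polyring_sum polyring_pderiv_var eqvec_polyring[OF F]) simp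
next
  fix g :: "complex mat" and \<rho> l
  assume g: "g \<in> carrier_mat N N" "det g \<noteq> 0" and l: "l < N"
  obtain h where h: "h \<in> carrier_mat N N" "g * h = 1\<^sub>m N" "h * g = 1\<^sub>m N"
    by (rule obtain_inverse_mat[OF g])
  have "det g ^ k * (\<Sum>p<N. ev (lact N g \<rho>) (pderiv_var (XV p l) (F p))) =
     (\<Sum>q<N. \<Sum>j<N. g $$ (l, j) * ev (ract N g \<rho>) (pderiv_var (XV q j) (F q)))"
  proof (rule trace_of_conjugation[where g = "\<lambda>i j. g $$ (i, j)" and h = "\<lambda>i j. h $$ (i, j)"
        and x = "\<lambda>i p. ev (lact N g \<rho>) (pderiv_var (XV i l) (F p))"
        and y = "\<lambda>c q. \<Sum>j<N. g $$ (l, j) * ev (ract N g \<rho>) (pderiv_var (XV c j) (F q))"])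
    fix c p assume c: "c < N" and p: "p < N"
    \<comment> \<open>The matrix unit at \<open>(c, l)\<close>: left multiplication by
      \<open>g\<close> puts column \<open>c\<close> of \<open>g\<close> into column
      \<open>l\<close>, right multiplication puts row \<open>l\<close> of \<open>g\<close> into row
      \<open>c\<close>.\<close>
    let ?e = "\<lambda>v. of_bool (v = XV c l) :: complex"
    have "lact N g ?e (XV i j) = of_bool (j = l) * g $$ (i, c)" for i j
    proof -
      have "lact N g ?e (XV i j) = (\<Sum>l'<N. if l' = c then of_bool (j = l) * g $$ (i, c) else 0)"
        unfolding lact.simps by (rule sum.cong) auto
      with c show ?thesis by (simp only: sum.delta finite_lessThan lessThan_iff if_True)
    qed
    then have *: "lact N g ?e (XV i j) * y = (if j = l then g $$ (i, c) * y else 0)" for i j y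
      by simp
    have "ract N g ?e (XV i j) = of_bool (i = c) * g $$ (l, j)" for i j
    proof -
      have "ract N g ?e (XV i j) = (\<Sum>l'<N. if l' = l then of_bool (i = c) * g $$ (l, j) else 0)"
        unfolding ract.simps by (rule sum.cong) auto
      with l show ?thesis by (simp only: sum.delta finite_lessThan lessThan_iff if_True)
    qed
    then have **: "ract N g ?e (XV i j) * y = (if i = c then g $$ (l, j) else 0) * y" for i j y
      by simp
    have A: "(\<Sum>i<N. \<Sum>j<N. (if i = c then F j else 0) * y i j) = (\<Sum>j<N. F j * y c j)"
      for F :: "nat \<Rightarrow> complex" and y
    proof -
      have "(\<Sum>i<N. \<Sum>j<N. (if i = c then F j else 0) * y i j) =
          (\<Sum>i<N. if i = c then \<Sum>j<N. F j * y i j else 0)"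
        by (rule sum.cong) auto
      with c show ?thesis by simp
    qed
    have X: "lact N g ?e (AV a j) = 0" "ract N g ?e (AV a j) = 0" for a j
      by simp_all
    from eqvec_line[OF F g p, of ?e \<rho>]
    show "det g ^ k * (\<Sum>i<N. g $$ (i, c) * ev (lact N g \<rho>) (pderiv_var (XV i l) (F p))) =
      (\<Sum>q<N. g $$ (p, q) * (\<Sum>j<N. g $$ (l, j) * ev (ract N g \<rho>) (pderiv_var (XV c j) (F q))))"
      unfolding sum_mvars * ** X A using l by (simp only: sum.delta finite_lessThan lessThan_iff
        if_True mult_zero_left mult_zero_right sum.neutral_const add_0_right)
  qed (rule mat_mult_eq_one_sum[OF g(1) h(1,2)] mat_mult_eq_one_sum[OF h(1) g(1) h(3)]; assumption)+
  also have "\<dots> = (\<Sum>j<N. g $$ (l, j) * (\<Sum>q<N. ev (ract N g \<rho>) (pderiv_var (XV q j) (F q))))"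
    by (subst sum.swap) (simp add: sum_distrib_left)
  finally show "det g ^ k * ev (lact N g \<rho>) (divvec N F l) =
     (\<Sum>j<N. g $$ (l, j) * ev (ract N g \<rho>) (divvec N F j))"
    by (simp add: divvec_def)
qed

text \<open>Holds because \<open>(g X) (g G) = g ((X g) G)\<close>.\<close>

lemma eqvec_Xmul:
  assumes G: "eqvec n k N G"
  shows "eqvec n k N (Xmul N G)"
  unfolding eqvec_def
proof (intro conjI allI impI ballI)
  fix p assume "p < N"
  then show "Xmul N G p \<in> polyring n N"
    unfolding Xmul_def by (intro polyring_sum polyring_mult polyring_Var eqvec_polyring[OF G]) simp_all
next
  fix g :: "complex mat" and \<rho> p
  assume g: "g \<in> carrier_mat N N" "det g \<noteq> 0" and p: "p < N"
  have "det g ^ k * ev (lact N g \<rho>) (Xmul N G p) =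
      (\<Sum>l<N. (\<Sum>i<N. g $$ (p, i) * \<rho> (XV i l)) * (det g ^ k * ev (lact N g \<rho>) (G l)))"
    by (simp add: Xmul_def sum_distrib_left mult_ac)
  also have "\<dots> = (\<Sum>l<N. (\<Sum>i<N. g $$ (p, i) * \<rho> (XV i l)) *
      (\<Sum>j<N. g $$ (l, j) * ev (ract N g \<rho>) (G j)))"
    by (simp add: eqvec_twisted[OF G g])
  also have "\<dots> = (\<Sum>l<N. \<Sum>i<N. \<Sum>j<N. g $$ (p, i) * (\<rho> (XV i l) * g $$ (l, j) * ev (ract N g \<rho>) (G j)))"
    by (simp add: sum_product mult_ac)
  also have "\<dots> = (\<Sum>i<N. \<Sum>l<N. \<Sum>j<N. g $$ (p, i) * (\<rho> (XV i l) * g $$ (l, j) * ev (ract N g \<rho>) (G j)))"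
    by (rule sum.swap)
  also have "\<dots> = (\<Sum>i<N. \<Sum>j<N. \<Sum>l<N. g $$ (p, i) * (\<rho> (XV i l) * g $$ (l, j) * ev (ract N g \<rho>) (G j)))"
    by (intro sum.cong refl sum.swap)
  also have "\<dots> = (\<Sum>i<N. g $$ (p, i) * ev (ract N g \<rho>) (Xmul N G i))"
    by (simp add: Xmul_def sum_distrib_left sum_distrib_right)
  finally show "det g ^ k * ev (lact N g \<rho>) (Xmul N G p) =
     (\<Sum>q<N. g $$ (p, q) * ev (ract N g \<rho>) (Xmul N G q))" .
qed

text \<open>A row of \<open>A\<close> absorbs the factor \<open>g\<close> coming from
  \<open>G\<close>, by \<open>A (g G) = (A g) G\<close>, so a scalar equivariant polynomial
  remains.\<close>

lemma Hspace_Amul: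
  assumes G: "eqvec n k N G" and a: "a < n"
  shows "Amul N a G \<in> Hspace n k N"
proof (rule HspaceI)
  show "Amul N a G \<in> polyring n N"
    unfolding Amul_def using a
    by (intro polyring_sum polyring_mult polyring_Var eqvec_polyring[OF G]) simp_all
  fix g :: "complex mat" and \<rho>
  assume g: "g \<in> carrier_mat N N" "det g \<noteq> 0"
  have "det g ^ k * ev (lact N g \<rho>) (Amul N a G) =
      (\<Sum>l<N. \<rho> (AV a l) * (det g ^ k * ev (lact N g \<rho>) (G l)))"
    by (simp add: Amul_def sum_distrib_left mult_ac)
  also have "\<dots> = (\<Sum>l<N. \<Sum>j<N. \<rho> (AV a l) * g $$ (l, j) * ev (ract N g \<rho>) (G j))"
    by (simp add: eqvec_twisted[OF G g] sum_distrib_left mult_ac)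
  also have "\<dots> = (\<Sum>j<N. \<Sum>l<N. \<rho> (AV a l) * g $$ (l, j) * ev (ract N g \<rho>) (G j))"
    by (rule sum.swap)
  also have "\<dots> = ev (ract N g \<rho>) (Amul N a G)"
    by (simp add: Amul_def sum_distrib_right)
  finally show "det g ^ k * ev (lact N g \<rho>) (Amul N a G) = ev (ract N g \<rho>) (Amul N a G)" .
qed

lemma eqvec_add:
  assumes "eqvec n k N F" "eqvec n k N G"
  shows "eqvec n k N (\<lambda>i. F i + G i)"
  using assms by (simp add: eqvec_def distrib_left sum.distrib)

lemma eqvec_Const_mult:
  assumes "eqvec n k N F"
  shows "eqvec n k N (\<lambda>i. Const c * F i)"
  unfolding eqvec_def
proof (intro conjI allI impI ballI)
  fix g :: "complex mat" and \<rho> p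
  assume g: "g \<in> carrier_mat N N" "det g \<noteq> 0" and p: "p < N"
  show "det g ^ k * ev (lact N g \<rho>) (Const c * F p) =
      (\<Sum>q<N. g $$ (p, q) * ev (ract N g \<rho>) (Const c * F q))"
    using arg_cong[where f = "\<lambda>x. c * x", OF eqvec_twisted[OF assms g p, of \<rho>]]
    by (simp add: sum_distrib_left mult_ac)
qed (use eqvec_polyring[OF assms] in auto)

section \<open>The operators \<open>A (XY)\<^sup>s B\<close>\<close>

definition XYB :: "nat \<Rightarrow> nat \<Rightarrow> nat \<Rightarrow> cpoly \<Rightarrow> nat \<Rightarrow> cpoly" where
  "XYB N s b f i = (\<Sum>j<N. XYpow N s i j (Bop j b f))"

lemma AXYB_eq_Amul: "AXYB N s a b f = Amul N a (XYB N s b f)"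
  by (simp add: AXYB_def Amul_def XYB_def sum_distrib_left)

lemma XYop_sum: "XYop N i j (\<Sum>x\<in>S. F x) = (\<Sum>x\<in>S. XYop N i j (F x))"
  unfolding XYop_def Yop_def pderiv_var_sum sum_distrib_left by (rule sum.swap)

lemma XYB_0: "i < N \<Longrightarrow> XYB N 0 b f i = Bop i b f"
  by (simp add: XYB_def)

lemma sum_XYop: "(\<Sum>j<N. XYop N i j (F j)) = Xmul N (divvec N F) i"
  unfolding XYop_def Yop_def Xmul_def divvec_def sum_distrib_left by (rule sum.swap)

text \<open>Replaces the power of the operator matrix by iteration of one map on vectors, the form
  in which equivariance and restriction to the slice are proved by induction.\<close>

lemma XYB_Suc: "XYB N (Suc s) b f i = Xmul N (divvec N (XYB N s b f)) i"
proof -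
  have "XYB N (Suc s) b f i = (\<Sum>l<N. XYop N i l (XYB N s b f l))"
    unfolding XYB_def XYpow.simps XYop_sum by (rule sum.swap)
  then show ?thesis by (simp add: sum_XYop)
qed

lemma eqvec_XYB:
  assumes "f \<in> Hspace n k N" "b < n"
  shows "eqvec n k N (XYB N s b f)"
proof (induction s)
  case 0
  show ?case
    by (subst eqvec_cong[where G = "\<lambda>i. Bop i b f"]) (simp_all add: XYB_0 eqvec_Bop[OF assms])
next
  case (Suc s)
  have "XYB N (Suc s) b f = Xmul N (divvec N (XYB N s b f))"
    by (rule ext) (rule XYB_Suc)
  with Suc show ?case by (simp add: eqvec_Xmul eqvec_divvec)
qed

lemma Hspace_AXYB: "f \<in> Hspace n k N \<Longrightarrow> a < n \<Longrightarrow> b < n \<Longrightarrow> AXYB N s a b f \<in> Hspace n k N"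
  unfolding AXYB_eq_Amul by (intro Hspace_Amul eqvec_XYB)

lemma Hspace_Tbracket:
  "f \<in> Hspace n k N \<Longrightarrow> a < n \<Longrightarrow> b < n \<Longrightarrow> Tbracket n k L N a b r f \<in> Hspace n k N"
  unfolding Tbracket_def
  by (intro Hspace_add Hspace_sum Hspace_Const_mult Hspace_AXYB) (auto simp: Hspace_zero)

lemma Hspace_Tcoeff:
  "f \<in> Hspace n k N \<Longrightarrow> a < n \<Longrightarrow> b < n \<Longrightarrow> Tcoeff n k L N a b r f \<in> Hspace n k N"
  unfolding Tcoeff_def by (intro Hspace_sum Hspace_Const_mult Hspace_Tbracket)

lemma of_nat_poly_ev: "ev \<rho> (of_nat c) = of_nat c"
  by (induction c) simp_all

section \<open>The infinitesimal form of equivariance\<close>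

text \<open>The curve \<open>1 + t E\<close> through the identity, with \<open>E\<close> the matrix
  unit at \<open>(j, m)\<close>. It is affine in \<open>t\<close>, so both actions move a point
  along straight lines, with directions \<open>left_dir\<close> and
  \<open>right_dir\<close>.\<close>

definition elem_mat :: "nat \<Rightarrow> nat \<Rightarrow> nat \<Rightarrow> complex \<Rightarrow> complex mat" where
  "elem_mat N j m t = mat N N (\<lambda>(p, q). of_bool (p = q) + t * of_bool (p = j \<and> q = m))"

lemma elem_mat_carrier [simp]: "elem_mat N j m t \<in> carrier_mat N N"
  by (simp add: elem_mat_def)

lemma det_elem_mat:
  assumes "j < N" "m < N"
  shows "det (elem_mat N j m t) = 1 + t * of_bool (j = m)"
proof (cases "j = m")
  case True
  then have "elem_mat N j m t = multrow_mat N j (1 + t)"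
    by (auto simp: elem_mat_def multrow_mat_def intro!: eq_matI)
  with True assms show ?thesis by (simp add: det_multrow_mat)
next
  case False
  then have "elem_mat N j m t = addrow_mat N t j m"
    by (auto simp: elem_mat_def addrow_mat_def intro!: eq_matI)
  with False show ?thesis by (simp add: det_addrow_mat)
qed

lemma sum_delta_plus:
  fixes F :: "nat \<Rightarrow> complex"
  assumes "p < N" "m < N"
  shows "(\<Sum>l<N. (of_bool (p = l) + t * of_bool (P \<and> l = m)) * F l) = F p + t * (if P then F m else 0)"
proof -
  have "(\<Sum>l<N. (of_bool (p = l) + t * of_bool (P \<and> l = m)) * F l) =
      (\<Sum>l<N. (if l = p then F l else 0) + (if l = m then t * (if P then F l else 0) else 0))"
    by (rule sum.cong) (auto simp: distrib_right)
  with assms show ?thesis by (simp add: sum.distrib)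
qed

definition left_dir :: "nat \<Rightarrow> nat \<Rightarrow> (mvar \<Rightarrow> complex) \<Rightarrow> mvar \<Rightarrow> complex" where
  "left_dir j m \<rho> v = (case v of XV i l \<Rightarrow> if i = j then \<rho> (XV m l) else 0 | AV a l \<Rightarrow> 0)"

definition right_dir :: "nat \<Rightarrow> nat \<Rightarrow> (mvar \<Rightarrow> complex) \<Rightarrow> mvar \<Rightarrow> complex" where
  "right_dir j m \<rho> v = (case v of XV i l \<Rightarrow> if l = m then \<rho> (XV i j) else 0
     | AV a l \<Rightarrow> if l = m then \<rho> (AV a j) else 0)"

lemma lact_elem_mat:
  assumes "j < N" "m < N" "v \<in> mvars n N"
  shows "lact N (elem_mat N j m t) \<rho> v = \<rho> v + t * left_dir j m \<rho> v"
proof (cases v)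
  case (XV i l)
  with assms have "lact N (elem_mat N j m t) \<rho> v =
      (\<Sum>q<N. (of_bool (i = q) + t * of_bool (i = j \<and> q = m)) * \<rho> (XV q l))"
    by (simp add: elem_mat_def)
  also have "\<dots> = \<rho> (XV i l) + t * (if i = j then \<rho> (XV m l) else 0)"
    by (rule sum_delta_plus) (use assms XV in auto)
  finally show ?thesis by (simp add: XV left_dir_def)
qed (simp add: left_dir_def)

lemma ract_elem_mat:
  assumes "j < N" "m < N" "v \<in> mvars n N"
  shows "ract N (elem_mat N j m t) \<rho> v = \<rho> v + t * right_dir j m \<rho> v"
proof -
  have *: "(\<Sum>q<N. F q * elem_mat N j m t $$ (q, l)) = F l + t * (if l = m then F j else 0)"
    if "l < N" for F l
  proof -
    have "(\<Sum>q<N. F q * elem_mat N j m t $$ (q, l)) =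
        (\<Sum>q<N. (of_bool (l = q) + t * of_bool (l = m \<and> q = j)) * F q)"
      by (rule sum.cong) (use that in \<open>auto simp: elem_mat_def\<close>)
    with that assms show ?thesis by (simp only: sum_delta_plus)
  qed
  show ?thesis
    using assms by (cases v) (simp_all add: * right_dir_def)
qed

text \<open>The derivative at \<open>t = 0\<close> of the twisted identity along
  \<open>elem_mat\<close>. The term with \<open>k\<close> comes from the determinant, and
  \<open>f'\<close> from the action of \<open>g\<close> on values: it is \<open>0\<close> for
  elements of \<open>Hspace\<close> and the entry at \<open>(j, m)\<close> contributes it for
  vectors.\<close>

lemma infinitesimal:
  assumes f: "f \<in> polyring n N" and f': "f' \<in> polyring n N" and jm: "j < N" "m < N"
    and tw: "\<And>t \<rho>. 1 + t * of_bool (j = m) \<noteq> 0 \<Longrightarrow>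
      (1 + t * of_bool (j = m)) ^ k * ev (lact N (elem_mat N j m t) \<rho>) f =
      ev (ract N (elem_mat N j m t) \<rho>) f + t * ev (ract N (elem_mat N j m t) \<rho>) f'"
  shows "Const (of_nat k * of_bool (j = m)) * f + (\<Sum>l<N. Var (XV m l) * pderiv_var (XV j l) f) =
    f' + (\<Sum>i<N. Var (XV i j) * pderiv_var (XV i m) f) + (\<Sum>a<n. Var (AV a j) * pderiv_var (AV a m) f)"
proof (rule ev_inject)
  fix \<rho>
  let ?d = "of_bool (j = m) :: complex"
  let ?l = "\<lambda>t. ev (\<lambda>v. \<rho> v + t * left_dir j m \<rho> v)"
  let ?r = "\<lambda>t. ev (\<lambda>v. \<rho> v + t * right_dir j m \<rho> v)"
  have eq: "(1 + t * ?d) ^ k * ?l t f = ?r t f + t * ?r t f'" if "1 + t * ?d \<noteq> 0" for t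
  proof -
    have "ev (lact N (elem_mat N j m t) \<rho>) f = ?l t f"
      by (rule ev_polyring_cong[OF f]) (rule lact_elem_mat[OF jm])
    moreover have "ev (ract N (elem_mat N j m t) \<rho>) f = ?r t f"
      by (rule ev_polyring_cong[OF f]) (rule ract_elem_mat[OF jm])
    moreover have "ev (ract N (elem_mat N j m t) \<rho>) f' = ?r t f'"
      by (rule ev_polyring_cong[OF f']) (rule ract_elem_mat[OF jm])
    ultimately show ?thesis using tw[OF that, of \<rho>] by simp
  qed
  have "((\<lambda>t. (1 + t * ?d) ^ k) has_field_derivative of_nat k * ?d) (at 0)"
    by (auto intro!: derivative_eq_intros)
  from DERIV_mult[OF this ev_polyring_line_deriv[OF f, of \<rho> "left_dir j m \<rho>"]]
  have 1: "((\<lambda>t. (1 + t * ?d) ^ k * ?l t f) has_field_derivative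
      of_nat k * ?d * ev \<rho> f + (\<Sum>v\<in>mvars n N. left_dir j m \<rho> v * ev \<rho> (pderiv_var v f))) (at 0)"
    by (simp add: add.commute)
  have "((\<lambda>t. t * ?r t f') has_field_derivative ev \<rho> f') (at 0)"
    using DERIV_mult[OF DERIV_ident ev_polyring_line_deriv[OF f', of \<rho> "right_dir j m \<rho>"]] by simp
  from DERIV_add[OF ev_polyring_line_deriv[OF f, of \<rho> "right_dir j m \<rho>"] this]
  have 2: "((\<lambda>t. ?r t f + t * ?r t f') has_field_derivative
      (\<Sum>v\<in>mvars n N. right_dir j m \<rho> v * ev \<rho> (pderiv_var v f)) + ev \<rho> f') (at 0)" .
  \<comment> \<open>For \<open>j = m\<close> the determinant \<open>1 + t\<close> can vanish, so the
    identity is used in the unit disc only, which suffices for derivatives at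
    \<open>0\<close>.\<close>
  have ev: "\<forall>\<^sub>F t in nhds 0. (1 + t * ?d) ^ k * ?l t f = ?r t f + t * ?r t f'"
    unfolding eventually_nhds_metric
  proof (intro exI[of _ "1::real"] conjI allI impI)
    fix t :: complex assume "dist t 0 < 1"
    then have "norm (t * ?d) < 1" by (cases "j = m") simp_all
    then have "1 + t * ?d \<noteq> 0" by (metis add_eq_0_iff norm_minus_cancel norm_one less_irrefl)
    then show "(1 + t * ?d) ^ k * ?l t f = ?r t f + t * ?r t f'" by (rule eq)
  qed simp
  have "((\<lambda>t. (1 + t * ?d) ^ k * ?l t f) has_field_derivative
      (\<Sum>v\<in>mvars n N. right_dir j m \<rho> v * ev \<rho> (pderiv_var v f)) + ev \<rho> f') (at 0)"
    using 2 DERIV_cong_ev[OF refl ev refl] by blast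
  from DERIV_unique[OF 1 this]
  have main: "of_nat k * ?d * ev \<rho> f + (\<Sum>v\<in>mvars n N. left_dir j m \<rho> v * ev \<rho> (pderiv_var v f)) =
    (\<Sum>v\<in>mvars n N. right_dir j m \<rho> v * ev \<rho> (pderiv_var v f)) + ev \<rho> f'" .
  have D: "(\<Sum>i<N. if i = c then F i else 0) = F c" if "c < N" for c and F :: "nat \<Rightarrow> complex"
    using that by simp
  have "(\<Sum>v\<in>mvars n N. left_dir j m \<rho> v * ev \<rho> (pderiv_var v f)) =
      (\<Sum>i<N. if i = j then \<Sum>l<N. \<rho> (XV m l) * ev \<rho> (pderiv_var (XV i l) f) else 0)"
  proof -
    have "(\<Sum>i<N. \<Sum>l<N. left_dir j m \<rho> (XV i l) * ev \<rho> (pderiv_var (XV i l) f)) =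
        (\<Sum>i<N. if i = j then \<Sum>l<N. \<rho> (XV m l) * ev \<rho> (pderiv_var (XV i l) f) else 0)"
      by (rule sum.cong[OF refl]) (simp add: left_dir_def)
    then show ?thesis unfolding sum_mvars by (simp add: left_dir_def)
  qed
  also note D[OF jm(1)]
  finally have L: "(\<Sum>v\<in>mvars n N. left_dir j m \<rho> v * ev \<rho> (pderiv_var v f)) =
      (\<Sum>l<N. \<rho> (XV m l) * ev \<rho> (pderiv_var (XV j l) f))" .
  have "(\<Sum>v\<in>mvars n N. right_dir j m \<rho> v * ev \<rho> (pderiv_var v f)) =
      (\<Sum>i<N. \<Sum>l<N. if l = m then \<rho> (XV i j) * ev \<rho> (pderiv_var (XV i l) f) else 0) +
      (\<Sum>a<n. \<Sum>l<N. if l = m then \<rho> (AV a j) * ev \<rho> (pderiv_var (AV a l) f) else 0)"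
    unfolding sum_mvars
    by (intro arg_cong2[where f = "(+)"] sum.cong refl) (simp_all add: right_dir_def)
  then have R: "(\<Sum>v\<in>mvars n N. right_dir j m \<rho> v * ev \<rho> (pderiv_var v f)) =
      (\<Sum>i<N. \<rho> (XV i j) * ev \<rho> (pderiv_var (XV i m) f)) +
      (\<Sum>a<n. \<rho> (AV a j) * ev \<rho> (pderiv_var (AV a m) f))"
    unfolding D[OF jm(2)] .
  show "ev \<rho> (Const (of_nat k * ?d) * f + (\<Sum>l<N. Var (XV m l) * pderiv_var (XV j l) f)) =
    ev \<rho> (f' + (\<Sum>i<N. Var (XV i j) * pderiv_var (XV i m) f) + (\<Sum>a<n. Var (AV a j) * pderiv_var (AV a m) f))"
    using main unfolding L R by (simp del: of_bool_eq_iff)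
qed

lemma Hspace_infinitesimal:
  assumes f: "f \<in> Hspace n k N" and jm: "j < N" "m < N"
  shows "Const (of_nat k * of_bool (j = m)) * f + (\<Sum>l<N. Var (XV m l) * pderiv_var (XV j l) f) =
    (\<Sum>i<N. Var (XV i j) * pderiv_var (XV i m) f) + (\<Sum>a<n. Var (AV a j) * pderiv_var (AV a m) f)"
proof -
  have "(1 + t * of_bool (j = m)) ^ k * ev (lact N (elem_mat N j m t) \<rho>) f =
      ev (ract N (elem_mat N j m t) \<rho>) f + t * ev (ract N (elem_mat N j m t) \<rho>) 0"
    if "1 + t * of_bool (j = m) \<noteq> 0" for t \<rho>
    using Hspace_twisted[OF f elem_mat_carrier[of N j m t], of \<rho>] that
    unfolding det_elem_mat[OF jm] by simp
  from infinitesimal[OF Hspace_polyring[OF f] polyring_0 jm this] show ?thesis by simp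
qed

lemma eqvec_infinitesimal:
  assumes F: "eqvec n k N F" and jm: "j < N" "m < N" and p: "p < N"
  shows "Const (of_nat k * of_bool (j = m)) * F p + (\<Sum>l<N. Var (XV m l) * pderiv_var (XV j l) (F p)) =
    (if p = j then F m else 0) + (\<Sum>i<N. Var (XV i j) * pderiv_var (XV i m) (F p)) +
    (\<Sum>a<n. Var (AV a j) * pderiv_var (AV a m) (F p))"
proof -
  have "(1 + t * of_bool (j = m)) ^ k * ev (lact N (elem_mat N j m t) \<rho>) (F p) =
      ev (ract N (elem_mat N j m t) \<rho>) (F p) + t * ev (ract N (elem_mat N j m t) \<rho>) (if p = j then F m else 0)"
    if "1 + t * of_bool (j = m) \<noteq> 0" for t \<rho>
  proof -
    have "(1 + t * of_bool (j = m)) ^ k * ev (lact N (elem_mat N j m t) \<rho>) (F p) =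
        (\<Sum>q<N. elem_mat N j m t $$ (p, q) * ev (ract N (elem_mat N j m t) \<rho>) (F q))"
      using eqvec_twisted[OF F elem_mat_carrier[of N j m t] _ p, of \<rho>] that
      unfolding det_elem_mat[OF jm] by simp
    also have "\<dots> = (\<Sum>q<N. (of_bool (p = q) + t * of_bool (p = j \<and> q = m)) *
        ev (ract N (elem_mat N j m t) \<rho>) (F q))"
      by (rule sum.cong) (use p in \<open>auto simp: elem_mat_def\<close>)
    also note sum_delta_plus[OF p jm(2)]
    finally show ?thesis by simp
  qed
  from infinitesimal[OF eqvec_polyring[OF F p] _ jm this] eqvec_polyring[OF F jm(2)]
  show ?thesis by simp
qed

text \<open>This is \<open>(YX + BA) F = (XY + k + n) F\<close>. Infinitesimal equivariance with
  \<open>p = j\<close>, summed over \<open>j\<close>, gives \<open>k + XY = N + ?XX + ?AA\<close> on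
  \<open>F\<close>; the product rule gives \<open>YX = N + ?XX\<close> and
  \<open>BA = n + ?AA\<close>.\<close>

lemma YX_BA_eqvec:
  assumes F: "eqvec n k N F" and m: "m < N"
  shows "divvec N (Xmul N F) m + (\<Sum>c<n. pderiv_var (AV c m) (Amul N c F)) =
    Xmul N (divvec N F) m + Const (of_nat (k + n)) * F m"
proof -
  let ?XX = "\<Sum>j<N. \<Sum>i<N. Var (XV i j) * pderiv_var (XV i m) (F j)"
  let ?AA = "\<Sum>j<N. \<Sum>a<n. Var (AV a j) * pderiv_var (AV a m) (F j)"
  have D: "(\<Sum>i<N. if i = m then G i else 0) = G m" "(\<Sum>i<N. if m = i then G i else 0) = G m"
    for G :: "nat \<Rightarrow> cpoly"
    using m by simp_all
  have "(\<Sum>j<N. Const (of_nat k * of_bool (j = m)) * F j + (\<Sum>l<N. Var (XV m l) * pderiv_var (XV j l) (F j))) =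
    (\<Sum>j<N. F m + (\<Sum>i<N. Var (XV i j) * pderiv_var (XV i m) (F j)) +
      (\<Sum>a<n. Var (AV a j) * pderiv_var (AV a m) (F j)))"
    by (rule sum.cong[OF refl]) (use eqvec_infinitesimal[OF F _ m] in auto)
  moreover have "(\<Sum>j<N. Const (of_nat k * of_bool (j = m)) * F j) = Const (of_nat k) * F m"
  proof -
    have "(\<Sum>j<N. Const (of_nat k * of_bool (j = m)) * F j) = (\<Sum>j<N. if j = m then Const (of_nat k) * F j else 0)"
      by (rule sum.cong) auto
    then show ?thesis unfolding D .
  qed
  moreover have "(\<Sum>j<N. \<Sum>l<N. Var (XV m l) * pderiv_var (XV j l) (F j)) = Xmul N (divvec N F) m"
    unfolding Xmul_def divvec_def sum_distrib_left by (rule sum.swap)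
  ultimately have 1: "Const (of_nat k) * F m + Xmul N (divvec N F) m = of_nat N * F m + ?XX + ?AA"
    by (simp add: sum.distrib)
  have "pderiv_var (XV l m) (Xmul N F l) = F m + (\<Sum>j<N. Var (XV l j) * pderiv_var (XV l m) (F j))" for l
  proof -
    have "pderiv_var (XV l m) (Xmul N F l) =
        (\<Sum>j<N. (if m = j then F j else 0) + Var (XV l j) * pderiv_var (XV l m) (F j))"
      unfolding Xmul_def pderiv_var_sum pderiv_var_mult pderiv_var_Var by (rule sum.cong) auto
    then show ?thesis unfolding sum.distrib D .
  qed
  then have 2: "divvec N (Xmul N F) m = of_nat N * F m + ?XX"
    unfolding divvec_def by (subst sum.swap) (simp add: sum.distrib)
  have "pderiv_var (AV c m) (Amul N c F) = F m + (\<Sum>j<N. Var (AV c j) * pderiv_var (AV c m) (F j))" for c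
  proof -
    have "pderiv_var (AV c m) (Amul N c F) =
        (\<Sum>j<N. (if m = j then F j else 0) + Var (AV c j) * pderiv_var (AV c m) (F j))"
      unfolding Amul_def pderiv_var_sum pderiv_var_mult pderiv_var_Var by (rule sum.cong) auto
    then show ?thesis unfolding sum.distrib D .
  qed
  then have 3: "(\<Sum>c<n. pderiv_var (AV c m) (Amul N c F)) = of_nat n * F m + ?AA"
    by (subst sum.swap) (simp add: sum.distrib)
  have 4: "Const (of_nat (k + n)) = Const (of_nat k) + of_nat n"
    by (rule ev_inject) (simp add: of_nat_poly_ev)
  have "divvec N (Xmul N F) m + (\<Sum>c<n. pderiv_var (AV c m) (Amul N c F)) =
      (of_nat N * F m + ?XX + ?AA) + of_nat n * F m"
    unfolding 2 3 by (simp only: ac_simps)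
  also have "\<dots> = Const (of_nat k) * F m + Xmul N (divvec N F) m + of_nat n * F m"
    unfolding 1 ..
  finally show ?thesis unfolding 4 by (simp add: algebra_simps)
qed

section \<open>The map \<open>p\<^sub>N\<close> as restriction to a slice\<close>

text \<open>\<open>slice N v\<close> is the entry \<open>v\<close> of the pair \<open>(X', A')\<close>.\<close>

fun slice :: "nat \<Rightarrow> mvar \<Rightarrow> cpoly" where
  "slice N (XV i j) = (if j < N then if i < N then Var (XV i j) else Var (AV (i - N) j) else 0)"
| "slice N (AV a i) = (if i = N + a then 1 else 0)"

lemma sum_split_at:
  fixes F :: "nat \<Rightarrow> 'a::comm_monoid_add"
  shows "(\<Sum>l<N + n. F l) = (\<Sum>l<N. F l) + (\<Sum>l<n. F (N + l))"
  by (induction n) (simp_all add: ac_simps)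

lemma pderiv_slice_XV:
  assumes "l < N" "m < N"
  shows "pderiv_var (XV l m) (psubst (slice N) f) = psubst (slice N) (pderiv_var (XV l m) f)"
proof (rule pderiv_var_psubst_shift)
  fix \<rho> t u
  show "ev (\<rho>(XV l m := \<rho> (XV l m) + t)) (slice N u) = ev \<rho> (slice N u) + (if u = XV l m then t else 0)"
    using assms by (cases u) auto
qed

text \<open>The lower left block of \<open>X'\<close> is \<open>A\<close>, so on the slice a
  derivative in \<open>A\<close> is a derivative in one of the last \<open>n\<close> rows of
  \<open>X'\<close>.\<close>

lemma pderiv_slice_AV:
  assumes "m < N"
  shows "pderiv_var (AV c m) (psubst (slice N) f) = psubst (slice N) (pderiv_var (XV (N + c) m) f)"
proof (rule pderiv_var_psubst_shift)
  fix \<rho> t u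
  show "ev (\<rho>(AV c m := \<rho> (AV c m) + t)) (slice N u) = ev \<rho> (slice N u) + (if u = XV (N + c) m then t else 0)"
    using assms by (cases u) auto
qed

lemma slice_polyring:
  assumes "f \<in> polyring n (N + n)"
  shows "psubst (slice N) f \<in> polyring n N"
proof (rule polyring_psubst[OF assms])
  fix v assume "v \<in> mvars n (N + n)"
  then show "slice N v \<in> polyring n N" by (cases v) auto
qed

text \<open>Embeds \<open>GL_N\<close> into \<open>GL_{N+n}\<close> with the same determinant. Left
  multiplication of \<open>X'\<close> changes \<open>X\<close> and keeps \<open>A\<close>; right
  multiplication changes both and fixes \<open>A' = (0 | 1)\<close>. So the slice is preserved and
  inherits \<open>lact\<close> and \<open>ract\<close>.\<close>

definition block_diag_one :: "nat \<Rightarrow> nat \<Rightarrow> complex mat \<Rightarrow> complex mat" where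
  "block_diag_one N n g = four_block_mat g (0\<^sub>m N n) (0\<^sub>m n N) (1\<^sub>m n)"

lemma block_diag_one_carrier: "g \<in> carrier_mat N N \<Longrightarrow> block_diag_one N n g \<in> carrier_mat (N + n) (N + n)"
  by (simp add: block_diag_one_def)

lemma det_block_diag_one: "g \<in> carrier_mat N N \<Longrightarrow> det (block_diag_one N n g) = det g"
  unfolding block_diag_one_def by (subst det_four_block_mat_upper_right_zero[of _ N _ n]) auto

lemma block_diag_one_index:
  assumes "g \<in> carrier_mat N N" "i < N + n" "j < N + n"
  shows "block_diag_one N n g $$ (i, j) =
    (if i < N then if j < N then g $$ (i, j) else 0 else of_bool (i = j))"
  using assms by (auto simp: block_diag_one_def)

lemma lact_slice:
  assumes g: "g \<in> carrier_mat N N" and v: "v \<in> mvars n (N + n)"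
  shows "lact (N + n) (block_diag_one N n g) (\<lambda>v. ev \<rho> (slice N v)) v = ev (lact N g \<rho>) (slice N v)"
proof (cases v)
  case (XV i j)
  then have ij: "i < N + n" "j < N + n" using v by auto
  show ?thesis
  proof (cases "i < N")
    case True
    then show ?thesis
      using XV ij g by (simp add: sum_split_at block_diag_one_index)
  next
    case False
    then have "(\<Sum>l<n. block_diag_one N n g $$ (i, N + l) * ev \<rho> (slice N (XV (N + l) j))) =
      (\<Sum>l<n. if l = i - N then ev \<rho> (slice N (XV (N + l) j)) else 0)"
      using ij by (intro sum.cong) (auto simp: block_diag_one_index[OF g])
    also have "\<dots> = ev \<rho> (slice N (XV i j))"
      using False ij by (subst sum.delta) auto
    finally have 1: "(\<Sum>l<n. block_diag_one N n g $$ (i, N + l) * ev \<rho> (slice N (XV (N + l) j))) =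
      ev \<rho> (slice N (XV i j))" .
    have 2: "(\<Sum>l<N. block_diag_one N n g $$ (i, l) * ev \<rho> (slice N (XV l j))) = 0"
      using False ij by (intro sum.neutral) (auto simp: block_diag_one_index[OF g])
    have "lact (N + n) (block_diag_one N n g) (\<lambda>v. ev \<rho> (slice N v)) v = ev \<rho> (slice N (XV i j))"
      unfolding XV lact.simps sum_split_at 1 2 by simp
    with False XV show ?thesis by simp
  qed
qed simp

lemma ract_slice:
  assumes g: "g \<in> carrier_mat N N" and v: "v \<in> mvars n (N + n)"
  shows "ract (N + n) (block_diag_one N n g) (\<lambda>v. ev \<rho> (slice N v)) v = ev (ract N g \<rho>) (slice N v)"
proof (cases v)
  case (XV i j)
  then have ij: "i < N + n" "j < N + n" using v by auto
  have 1: "(\<Sum>l<n. ev \<rho> (slice N (XV i (N + l))) * block_diag_one N n g $$ (N + l, j)) = 0"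
    by (intro sum.neutral) auto
  have 2: "(\<Sum>l<N. ev \<rho> (slice N (XV i l)) * block_diag_one N n g $$ (l, j)) = ev (ract N g \<rho>) (slice N (XV i j))"
    using ij by (auto simp: block_diag_one_index[OF g] intro!: sum.cong)
  show ?thesis unfolding XV ract.simps sum_split_at 1 2 by simp
next
  case (AV a i)
  then have ai: "a < n" "i < N + n" using v by auto
  have "(\<Sum>l<n. ev \<rho> (slice N (AV a (N + l))) * block_diag_one N n g $$ (N + l, i)) =
     (\<Sum>l<n. if l = a then of_bool (N + l = i) else 0)"
    by (rule sum.cong) (use ai in \<open>auto simp: block_diag_one_index[OF g]\<close>)
  then have 1: "(\<Sum>l<n. ev \<rho> (slice N (AV a (N + l))) * block_diag_one N n g $$ (N + l, i)) = of_bool (N + a = i)"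
    using ai by simp
  have 2: "(\<Sum>l<N. ev \<rho> (slice N (AV a l)) * block_diag_one N n g $$ (l, i)) = 0"
    by (intro sum.neutral) auto
  show ?thesis unfolding AV ract.simps sum_split_at 1 2 by auto
qed

lemma Hspace_slice:
  assumes f: "f \<in> Hspace n k (N + n)"
  shows "psubst (slice N) f \<in> Hspace n k N"
proof (rule HspaceI)
  note fp = Hspace_polyring[OF f]
  show "psubst (slice N) f \<in> polyring n N" using fp by (rule slice_polyring)
  fix g :: "complex mat" and \<rho>
  assume g: "g \<in> carrier_mat N N" "det g \<noteq> 0"
  have "ev (\<lambda>v. ev (lact N g \<rho>) (slice N v)) f =
      ev (lact (N + n) (block_diag_one N n g) (\<lambda>v. ev \<rho> (slice N v))) f"
    by (rule ev_polyring_cong[OF fp], rule lact_slice[OF g(1), symmetric])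
  moreover have "ev (\<lambda>v. ev (ract N g \<rho>) (slice N v)) f =
      ev (ract (N + n) (block_diag_one N n g) (\<lambda>v. ev \<rho> (slice N v))) f"
    by (rule ev_polyring_cong[OF fp], rule ract_slice[OF g(1), symmetric])
  moreover have "det g ^ k * ev (lact (N + n) (block_diag_one N n g) (\<lambda>v. ev \<rho> (slice N v))) f =
      ev (ract (N + n) (block_diag_one N n g) (\<lambda>v. ev \<rho> (slice N v))) f"
    using Hspace_twisted[OF f block_diag_one_carrier[OF g(1)], of "\<lambda>v. ev \<rho> (slice N v)"] g
    by (simp add: det_block_diag_one)
  ultimately show "det g ^ k * ev (lact N g \<rho>) (psubst (slice N) f) = ev (ract N g \<rho>) (psubst (slice N) f)"
    unfolding ev_psubst by simp
qed

section \<open>Identification of \<open>p_N\<close> with the restriction to the slice\<close>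

lemma Hspace_eval_mult_left:
  assumes q: "q \<in> Hspace n k N" and X: "X \<in> carrier_mat N N" "det X \<noteq> 0" and A: "A \<in> carrier_mat n N"
  shows "det X ^ k * eval_at q X A = eval_at q X (A * X)"
proof -
  note qp = Hspace_polyring[OF q]
  \<comment> \<open>Equivariance at \<open>Z = 1\<close>, \<open>C = A\<close> with \<open>X\<close>
    itself as group element; this is the source of the factor \<open>det(X)^k\<close> in the
    characterization of \<open>p_N\<close>.\<close>
  have "ev (entry (X * 1\<^sub>m N) A) q = ev (lact N X (entry (1\<^sub>m N) A)) q"
    by (rule ev_polyring_cong[OF qp], rule lact_entry[OF X(1)]) auto
  moreover have "ev (entry (1\<^sub>m N * X) (A * X)) q = ev (ract N X (entry (1\<^sub>m N) A)) q"
    by (rule ev_polyring_cong[OF qp], rule ract_entry[OF X(1) _ A]) auto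
  ultimately show ?thesis
    using Hspace_twisted[OF q X, of "entry (1\<^sub>m N) A"] X(1) by (simp add: eval_at_eq_ev)
qed

lemma entry_slice:
  assumes X: "X \<in> carrier_mat N N" and A: "A \<in> carrier_mat n N" and v: "v \<in> mvars n (N + n)"
  shows "entry (four_block_mat X (0\<^sub>m N n) A (0\<^sub>m n n)) (four_block_mat (0\<^sub>m n N) (1\<^sub>m n) (0\<^sub>m 0 N) (0\<^sub>m 0 n)) v =
    ev (entry X A) (slice N v)"
  using assms by (cases v) auto

text \<open>Conjugation by \<open>((1, 0), (-\<eta>\<inverse>A, \<eta>\<inverse>))\<close> moves \<open>(diag(X, 0), (A | \<eta>))\<close> to the point of the
  slice with coordinates \<open>(X, A X)\<close>.\<close>

lemma eval_block_diag:
  assumes f: "f \<in> Hspace n k (N + n)" and X: "X \<in> carrier_mat N N" and A: "A \<in> carrier_mat n N"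
    and \<eta>: "\<eta> \<in> carrier_mat n n" "det \<eta> \<noteq> 0"
  shows "eval_at f (four_block_mat X (0\<^sub>m N n) (0\<^sub>m n N) (0\<^sub>m n n))
      (four_block_mat A \<eta> (0\<^sub>m 0 N) (0\<^sub>m 0 n)) = det \<eta> ^ k * eval_at (psubst (slice N) f) X (A * X)"
proof -
  obtain h where h: "h \<in> carrier_mat n n" "\<eta> * h = 1\<^sub>m n" "h * \<eta> = 1\<^sub>m n"
    by (rule obtain_inverse_mat[OF \<eta>])
  note fp = Hspace_polyring[OF f]
  define hA where "hA = - (h * A)"
  have hA: "hA \<in> carrier_mat n N" using h A by (simp add: hA_def)
  define g where "g = four_block_mat (1\<^sub>m N) (0\<^sub>m N n) hA h"
  define Z where "Z = four_block_mat X (0\<^sub>m N n) (A * X) (0\<^sub>m n n)"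
  define C where "C = four_block_mat A \<eta> (0\<^sub>m 0 N) (0\<^sub>m 0 n)"
  have AX: "A * X \<in> carrier_mat n N" using A X by simp
  have g: "g \<in> carrier_mat (N + n) (N + n)" using h by (simp add: g_def)
  have Z: "Z \<in> carrier_mat (N + n) (N + n)" using X by (simp add: Z_def)
  have C: "C \<in> carrier_mat n (N + n)" using A \<eta> four_block_carrier_mat[of A n N "0\<^sub>m 0 n" 0 n]
    by (simp add: C_def)
  have dg: "det g = det h"
    unfolding g_def by (subst det_four_block_mat_upper_right_zero[OF _ refl hA h(1)]) simp_all
  have d: "det \<eta> * det h = 1" using det_mult[OF \<eta>(1) h(1)] h by simp
  have z1: "hA * X + h * (A * X) = 0\<^sub>m n N"
  proof -
    have "h * A \<in> carrier_mat n N" using h A by simp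
    then have "hA * X = - (h * A * X)" unfolding hA_def using X by (subst uminus_mult_left_mat) auto
    then show ?thesis
      using h A X by (simp add: assoc_mult_mat[of h n n A N X N] uminus_l_inv_mat[of _ n N])
  qed
  have z2: "A + \<eta> * hA = 0\<^sub>m n N"
  proof -
    have "\<eta> * hA = - (\<eta> * (h * A))" unfolding hA_def using h A \<eta> by simp
    also have "\<eta> * (h * A) = \<eta> * h * A" using h(1) A \<eta>(1) by (intro assoc_mult_mat[symmetric])
    also have "\<dots> = A" unfolding h(2) using A by simp
    finally show ?thesis using A by (auto intro!: eq_matI)
  qed
  have gZ: "g * Z = four_block_mat X (0\<^sub>m N n) (0\<^sub>m n N) (0\<^sub>m n n)"
    unfolding g_def Z_def using h X A hA AX z1
    by (subst mult_four_block_mat[of _ N N _ n _ n _ _ N _ n]) auto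
  \<comment> \<open>\<open>Z\<close> is unchanged because its last block column is zero, and
    \<open>C g = (A + \<eta> hA | \<eta> h)\<close> will be \<open>(0 | 1)\<close>. Equivariance
    under \<open>g\<close> thus relates the block diagonal point to a point of the slice.\<close>
  have Zg: "Z * g = Z"
    unfolding g_def Z_def using h X A hA AX
    by (subst mult_four_block_mat[of _ N N _ n _ n _ _ N _ n]) auto
  have Cg: "C * g = four_block_mat (0\<^sub>m n N) (1\<^sub>m n) (0\<^sub>m 0 N) (0\<^sub>m 0 n)"
    unfolding g_def C_def using h X A hA \<eta> z2
    by (subst mult_four_block_mat[of _ n N _ n _ 0 _ _ N _ n]) auto
  have "ev (entry (g * Z) C) f = ev (lact (N + n) g (entry Z C)) f"
    by (rule ev_polyring_cong[OF fp], rule lact_entry[OF g Z])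
  moreover have "ev (entry (Z * g) (C * g)) f = ev (ract (N + n) g (entry Z C)) f"
    by (rule ev_polyring_cong[OF fp], rule ract_entry[OF g Z C])
  moreover have "ev (entry (Z * g) (C * g)) f = ev (entry X (A * X)) (psubst (slice N) f)"
    unfolding ev_psubst Zg Cg
    by (rule ev_polyring_cong[OF fp]) (unfold Z_def, rule entry_slice[OF X AX])
  moreover have "det h \<noteq> 0" using d by auto
  ultimately have "det h ^ k * eval_at f (g * Z) C = eval_at (psubst (slice N) f) X (A * X)"
    using Hspace_twisted[OF f g, of "entry Z C"] by (simp add: eval_at_eq_ev dg)
  then have "det \<eta> ^ k * (det h ^ k * eval_at f (g * Z) C) = det \<eta> ^ k * eval_at (psubst (slice N) f) X (A * X)"
    by simp
  moreover have "det \<eta> ^ k * (det h ^ k * y) = y" for y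
    unfolding mult.assoc[symmetric] power_mult_distrib[symmetric] d by simp
  ultimately show ?thesis unfolding gZ C_def by simp
qed

text \<open>Serves to extend identities from invertible matrices to all matrices: after adding
  \<open>t\<close> times the identity the determinant is a nonzero polynomial in \<open>t\<close>,
  and \<open>t\<close> tends to \<open>0\<close>.\<close>

lemma eq_at_zero_if_eq_off_roots:
  fixes F G :: "complex \<Rightarrow> complex"
  assumes P: "P \<noteq> 0" and FG: "\<And>t. poly P t \<noteq> 0 \<Longrightarrow> F t = G t" and c: "isCont F 0" "isCont G 0"
  shows "F 0 = G 0"
proof -
  \<comment> \<open>\<open>0\<close> is taken out of the exceptional set since it may itself be a
    root; the limit at \<open>0\<close> ignores the values there.\<close>
  have "finite ({t. poly P t = 0} - {0})" using poly_roots_finite[OF P] by simp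
  then have "open (- ({t. poly P t = 0} - {0}))" by (intro open_Compl finite_imp_closed)
  then have "\<forall>\<^sub>F t in at 0. F t = G t"
    unfolding eventually_at_topological using FG by (intro exI[of _ "- ({t. poly P t = 0} - {0})"]) auto
  moreover have "(F \<longlongrightarrow> F 0) (at 0)" "(G \<longlongrightarrow> G 0) (at 0)" using c by (simp_all add: isCont_def)
  ultimately show ?thesis
    by (metis (mono_tags, lifting) LIM_unique tendsto_cong)
qed

text \<open>The shifted determinant is the characteristic polynomial of \<open>- X\<close> at
  \<open>t\<close>, which is monic and hence nonzero.\<close>

lemma det_shift_poly:
  fixes X :: "complex mat"
  assumes X: "X \<in> carrier_mat N N"
  obtains P where "P \<noteq> 0" "\<And>t. det (X + t \<cdot>\<^sub>m 1\<^sub>m N) = poly P t"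
proof
  have m: "- X \<in> carrier_mat N N" using X by simp
  show "char_poly (- X) \<noteq> 0"
    using degree_monic_char_poly[OF m] by (metis coeff_0 zero_neq_one)
  fix t
  have "X + t \<cdot>\<^sub>m 1\<^sub>m N = - char_matrix (- X) t"
    using X by (auto simp: char_matrix_def intro!: eq_matI)
  then show "det (X + t \<cdot>\<^sub>m 1\<^sub>m N) = poly (char_poly (- X)) t"
    using char_poly_matrix[OF m] by simp
qed

lemma isCont_ev_line:
  assumes "f \<in> polyring n N" "\<And>t v. v \<in> mvars n N \<Longrightarrow> \<rho> t v = \<rho>\<^sub>0 v + t * e v"
  shows "isCont (\<lambda>t. ev (\<rho> t) f) 0"
proof -
  have "(\<lambda>t. ev (\<rho> t) f) = (\<lambda>t. ev (\<lambda>v. \<rho>\<^sub>0 v + t * e v) f)"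
    by (rule ext, rule ev_polyring_cong[OF assms(1)], rule assms(2))
  then show ?thesis
    using DERIV_isCont[OF ev_polyring_line_deriv[OF assms(1)]] by simp
qed

text \<open>Used for the uniqueness of \<open>p_N(f)\<close>, where the factor
  \<open>det(X)^k\<close> can be cancelled at invertible \<open>X\<close> only.\<close>

lemma polyring_eq_if_eval_eq:
  assumes q: "q \<in> polyring n N" "r \<in> polyring n N"
    and eq: "\<And>X A. X \<in> carrier_mat N N \<Longrightarrow> det X \<noteq> 0 \<Longrightarrow> A \<in> carrier_mat n N \<Longrightarrow>
      eval_at q X A = eval_at r X A"
  shows "q = r"
proof (rule ev_inject)
  fix \<rho> :: "mvar \<Rightarrow> complex"
  define X where "X = mat N N (\<lambda>(i, j). \<rho> (XV i j))"
  define A where "A = mat n N (\<lambda>(a, i). \<rho> (AV a i))"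
  have X: "X \<in> carrier_mat N N" and A: "A \<in> carrier_mat n N" by (simp_all add: X_def A_def)
  obtain P where P: "P \<noteq> 0" "\<And>t. det (X + t \<cdot>\<^sub>m 1\<^sub>m N) = poly P t"
    using det_shift_poly[OF X] by blast
  let ?e = "\<lambda>v. case v of XV i j \<Rightarrow> of_bool (i = j) | AV a i \<Rightarrow> 0"
  have line: "entry (X + t \<cdot>\<^sub>m 1\<^sub>m N) A v = \<rho> v + t * ?e v" if "v \<in> mvars n N" for t v
    using that by (cases v) (auto simp: X_def A_def)
  have "ev (entry (X + 0 \<cdot>\<^sub>m 1\<^sub>m N) A) q = ev (entry (X + 0 \<cdot>\<^sub>m 1\<^sub>m N) A) r"
  proof (rule eq_at_zero_if_eq_off_roots[OF P(1)])
    fix t assume "poly P t \<noteq> 0"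
    then show "ev (entry (X + t \<cdot>\<^sub>m 1\<^sub>m N) A) q = ev (entry (X + t \<cdot>\<^sub>m 1\<^sub>m N) A) r"
      using eq[of "X + t \<cdot>\<^sub>m 1\<^sub>m N" A] X A P(2) by (simp add: eval_at_eq_ev)
  qed (rule isCont_ev_line[OF q(1) line] isCont_ev_line[OF q(2) line]; assumption)+
  moreover have "ev (entry (X + 0 \<cdot>\<^sub>m 1\<^sub>m N) A) p = ev \<rho> p" if "p \<in> polyring n N" for p
    by (rule ev_polyring_cong[OF that]) (simp add: line)
  ultimately show "ev \<rho> q = ev \<rho> r" using q by simp
qed

text \<open>For invertible \<open>X\<close> and \<open>\<eta>\<close> this is
  \<open>eval_block_diag\<close> followed by \<open>Hspace_eval_mult_left\<close>, which turns
  \<open>A X\<close> back into \<open>A\<close> and yields \<open>det(X)^k\<close>. Shifting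
  \<open>X\<close> and \<open>\<eta>\<close> simultaneously by multiples of the identity reaches the
  singular case by continuity.\<close>

lemma slice_characterization:
  assumes f: "f \<in> Hspace n k (N + n)" and X: "X \<in> carrier_mat N N" and A: "A \<in> carrier_mat n N"
    and \<eta>: "\<eta> \<in> carrier_mat n n"
  shows "eval_at f (four_block_mat X (0\<^sub>m N n) (0\<^sub>m n N) (0\<^sub>m n n))
      (four_block_mat A \<eta> (0\<^sub>m 0 N) (0\<^sub>m 0 n)) = det X ^ k * det \<eta> ^ k * eval_at (psubst (slice N) f) X A"
proof -
  let ?q = "psubst (slice N) f"
  note fp = Hspace_polyring[OF f]
  note qH = Hspace_slice[OF f]
  define X' where "X' = (\<lambda>t. X + t \<cdot>\<^sub>m 1\<^sub>m N)"
  define \<eta>' where "\<eta>' = (\<lambda>t. \<eta> + t \<cdot>\<^sub>m 1\<^sub>m n)"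
  have X': "X' t \<in> carrier_mat N N" and \<eta>': "\<eta>' t \<in> carrier_mat n n" for t
    using X \<eta> by (simp_all add: X'_def \<eta>'_def)
  have 0: "X' 0 = X" "\<eta>' 0 = \<eta>" using X \<eta> by (auto simp: X'_def \<eta>'_def intro!: eq_matI)
  obtain P where P: "P \<noteq> 0" "\<And>t. det (X' t) = poly P t"
    using det_shift_poly[OF X] unfolding X'_def by blast
  obtain Q where Q: "Q \<noteq> 0" "\<And>t. det (\<eta>' t) = poly Q t"
    using det_shift_poly[OF \<eta>] unfolding \<eta>'_def by blast
  let ?X = "\<lambda>t. four_block_mat (X' t) (0\<^sub>m N n) (0\<^sub>m n N) (0\<^sub>m n n)"
  let ?A = "\<lambda>t. four_block_mat A (\<eta>' t) (0\<^sub>m 0 N) (0\<^sub>m 0 n)"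
  let ?e = "\<lambda>v. case v of XV i j \<Rightarrow> of_bool (i = j \<and> i < N) | AV a i \<Rightarrow> of_bool (i = N + a)"
  have "ev (entry (?X 0) (?A 0)) f = poly P 0 ^ k * poly Q 0 ^ k * ev (entry (X' 0) A) ?q"
  proof (rule eq_at_zero_if_eq_off_roots[of "P * Q"])
    fix t assume "poly (P * Q) t \<noteq> 0"
    then have nz: "det (X' t) \<noteq> 0" "det (\<eta>' t) \<noteq> 0" by (simp_all add: P Q)
    have "eval_at f (?X t) (?A t) = det (\<eta>' t) ^ k * (det (X' t) ^ k * eval_at ?q (X' t) A)"
      using eval_block_diag[OF f X' A \<eta>' nz(2)] Hspace_eval_mult_left[OF qH X' nz(1) A] by simp
    then show "ev (entry (?X t) (?A t)) f = poly P t ^ k * poly Q t ^ k * ev (entry (X' t) A) ?q"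
      by (simp add: eval_at_eq_ev P Q)
  next
    show "isCont (\<lambda>t. ev (entry (?X t) (?A t)) f) 0"
    proof (rule isCont_ev_line[OF fp])
      fix t v assume "v \<in> mvars n (N + n)"
      then show "entry (?X t) (?A t) v = entry (?X 0) (?A 0) v + t * ?e v"
        using X A \<eta> by (cases v) (auto simp: X'_def \<eta>'_def)
    qed
    have "isCont (\<lambda>t. ev (entry (X' t) A) ?q) 0"
    proof (rule isCont_ev_line[OF Hspace_polyring[OF qH]])
      fix t v assume "v \<in> mvars n N"
      then show "entry (X' t) A v = entry X A v + t * ?e v"
        using X A by (cases v) (auto simp: X'_def)
    qed
    then show "isCont (\<lambda>t. poly P t ^ k * poly Q t ^ k * ev (entry (X' t) A) ?q) 0"
      by (intro continuous_intros)
  qed (use P Q in simp)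
  then show ?thesis by (simp add: 0 eval_at_eq_ev P(2)[symmetric] Q(2)[symmetric])
qed

lemma pmap_eq_slice:
  assumes f: "f \<in> Hspace n k (N + n)"
  shows "pmap n k N f = psubst (slice N) f"
  unfolding pmap_def
proof (rule the_equality)
  show "psubst (slice N) f \<in> Hspace n k N \<and>
     (\<forall>X \<in> carrier_mat N N. \<forall>A \<in> carrier_mat n N. \<forall>\<eta> \<in> carrier_mat n n.
        eval_at f (four_block_mat X (0\<^sub>m N n) (0\<^sub>m n N) (0\<^sub>m n n))
                  (four_block_mat A \<eta> (0\<^sub>m 0 N) (0\<^sub>m 0 n))
        = det X ^ k * det \<eta> ^ k * eval_at (psubst (slice N) f) X A)"
    using Hspace_slice[OF f] slice_characterization[OF f] by blast
next
  fix q assume q: "q \<in> Hspace n k N \<and>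
     (\<forall>X \<in> carrier_mat N N. \<forall>A \<in> carrier_mat n N. \<forall>\<eta> \<in> carrier_mat n n.
        eval_at f (four_block_mat X (0\<^sub>m N n) (0\<^sub>m n N) (0\<^sub>m n n))
                  (four_block_mat A \<eta> (0\<^sub>m 0 N) (0\<^sub>m 0 n))
        = det X ^ k * det \<eta> ^ k * eval_at q X A)"
  show "q = psubst (slice N) f"
  proof (rule polyring_eq_if_eval_eq)
    show "q \<in> polyring n N" "psubst (slice N) f \<in> polyring n N"
      using q Hspace_slice[OF f] by (blast intro: Hspace_polyring)+
    fix X A :: "complex mat"
    assume X: "X \<in> carrier_mat N N" "det X \<noteq> 0" and A: "A \<in> carrier_mat n N"
    have "det X ^ k * det (1\<^sub>m n) ^ k * eval_at q X A =
        det X ^ k * det (1\<^sub>m n) ^ k * eval_at (psubst (slice N) f) X A"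
      using q slice_characterization[OF f X(1) A one_carrier_mat] X(1) A by (metis one_carrier_mat)
    with X(2) show "eval_at q X A = eval_at (psubst (slice N) f) X A" by simp
  qed
qed

section \<open>Restriction of \<open>A (XY)\<^sup>s B\<close> to the slice\<close>

text \<open>\<open>(XY + k + n)\<^sup>s B\<^sub>b q\<close>, and below it the vector \<open>V\<^sub>s\<close>.\<close>

primrec shifted_XYB :: "nat \<Rightarrow> nat \<Rightarrow> nat \<Rightarrow> nat \<Rightarrow> cpoly \<Rightarrow> nat \<Rightarrow> nat \<Rightarrow> cpoly" where
  "shifted_XYB n k N b q 0 = XYB N 0 b q"
| "shifted_XYB n k N b q (Suc s) = (\<lambda>i. Xmul N (divvec N (shifted_XYB n k N b q s)) i +
     Const (of_nat (k + n)) * shifted_XYB n k N b q s i)"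

fun sliced_XYB :: "nat \<Rightarrow> nat \<Rightarrow> nat \<Rightarrow> nat \<Rightarrow> cpoly \<Rightarrow> nat \<Rightarrow> nat \<Rightarrow> cpoly" where
  "sliced_XYB n k N b q 0 = shifted_XYB n k N b q 0"
| "sliced_XYB n k N b q (Suc s) = (\<lambda>i. shifted_XYB n k N b q (Suc s) i +
     Const (of_nat k) * shifted_XYB n k N b q s i)"

lemma eqvec_shifted_XYB:
  assumes "q \<in> Hspace n k N" "b < n"
  shows "eqvec n k N (shifted_XYB n k N b q s)"
  by (induction s)
    (simp_all add: eqvec_XYB[OF assms] eqvec_add eqvec_Const_mult eqvec_Xmul eqvec_divvec)

lemma eqvec_sliced_XYB:
  assumes "q \<in> Hspace n k N" "b < n"
  shows "eqvec n k N (sliced_XYB n k N b q s)"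
  by (cases s) (simp_all only: sliced_XYB.simps eqvec_shifted_XYB[OF assms] eqvec_add eqvec_Const_mult)

lemma divvec_linear:
  "divvec N (\<lambda>i. F i + Const c * G i) l = divvec N F l + Const c * divvec N G l"
  by (simp add: divvec_def pderiv_var_add pderiv_var_Const_mult sum.distrib sum_distrib_left)

lemma Xmul_linear:
  "Xmul N (\<lambda>i. F i + Const c * G i) l = Xmul N F l + Const c * Xmul N G l"
  by (simp add: Xmul_def sum.distrib sum_distrib_left algebra_simps)

lemma Amul_linear:
  "Amul N a (\<lambda>i. F i + Const c * G i) = Amul N a F + Const c * Amul N a G"
  by (simp add: Amul_def sum.distrib sum_distrib_left algebra_simps)

lemma Xmul_divvec_linear:
  "Xmul N (divvec N (\<lambda>i. F i + Const c * G i)) = (\<lambda>i. Xmul N (divvec N F) i + Const c * Xmul N (divvec N G) i)"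
  by (rule ext) (simp add: divvec_linear[abs_def] Xmul_linear)

lemma divvec_cong: "(\<And>m. m < N \<Longrightarrow> F m = G m) \<Longrightarrow> divvec N F = divvec N G"
  by (rule ext) (simp add: divvec_def)

text \<open>The last \<open>n\<close> columns of \<open>X'\<close> are zero, so derivatives across
  the slice are multiplied by zero. Those in the first \<open>N\<close> columns are derivatives in
  \<open>X\<close> and \<open>A\<close> along the slice.\<close>

lemma slice_Xmul_divvec:
  "psubst (slice N) (Xmul (N + n) (divvec (N + n) F) i) =
    (\<Sum>m<N. slice N (XV i m) * (divvec N (\<lambda>l. psubst (slice N) (F l)) m +
      (\<Sum>c<n. pderiv_var (AV c m) (psubst (slice N) (F (N + c))))))"
proof -
  have "psubst (slice N) (divvec (N + n) F m) = divvec N (\<lambda>l. psubst (slice N) (F l)) m +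
      (\<Sum>c<n. pderiv_var (AV c m) (psubst (slice N) (F (N + c))))" if "m < N" for m
    unfolding divvec_def sum_split_at psubst_add psubst_sum using that
    by (simp add: pderiv_slice_XV pderiv_slice_AV)
  then show ?thesis
    unfolding Xmul_def sum_split_at psubst_add psubst_sum psubst_mult psubst_Var by simp
qed

lemma slice_row_low: "i < N \<Longrightarrow> (\<Sum>m<N. slice N (XV i m) * G m) = Xmul N G i"
  by (simp add: Xmul_def)

lemma slice_row_high: "(\<Sum>m<N. slice N (XV (N + c) m) * G m) = Amul N c G"
  by (simp add: Amul_def)

text \<open>Infinitesimal equivariance with \<open>j = N + b\<close> and \<open>m = i\<close>. On
  the slice column \<open>N + b\<close> of \<open>X'\<close> is zero and that of \<open>A'\<close>
  is a unit vector, which isolates the wanted derivative and expresses it through derivatives along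
  the slice.\<close>

lemma slice_Bop:
  assumes f: "f \<in> Hspace n k (N + n)" and b: "b < n" and i: "i < N + n"
  shows "psubst (slice N) (Bop i b f) = Const (of_nat k * of_bool (N + b = i)) * psubst (slice N) f +
    (\<Sum>m<N. slice N (XV i m) * Bop m b (psubst (slice N) f))"
proof -
  have "psubst (slice N) (Const (of_nat k * of_bool (N + b = i)) * f +
      (\<Sum>l<N + n. Var (XV i l) * pderiv_var (XV (N + b) l) f)) =
    psubst (slice N) ((\<Sum>j<N + n. Var (XV j (N + b)) * pderiv_var (XV j i) f) +
      (\<Sum>a<n. Var (AV a (N + b)) * pderiv_var (AV a i) f))"
    using Hspace_infinitesimal[OF f _ i, of "N + b"] b by simp
  moreover have "psubst (slice N) (\<Sum>l<N + n. Var (XV i l) * pderiv_var (XV (N + b) l) f) =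
      (\<Sum>m<N. slice N (XV i m) * Bop m b (psubst (slice N) f))"
    unfolding sum_split_at psubst_add psubst_sum psubst_mult psubst_Var Bop_def
    by (simp add: pderiv_slice_AV)
  moreover have "psubst (slice N) (\<Sum>j<N + n. Var (XV j (N + b)) * pderiv_var (XV j i) f) = 0"
    unfolding psubst_sum psubst_mult psubst_Var by simp
  moreover have "psubst (slice N) (\<Sum>a<n. Var (AV a (N + b)) * pderiv_var (AV a i) f) =
      psubst (slice N) (Bop i b f)"
  proof -
    have "psubst (slice N) (\<Sum>a<n. Var (AV a (N + b)) * pderiv_var (AV a i) f) =
        (\<Sum>a<n. if a = b then psubst (slice N) (pderiv_var (AV a i) f) else 0)"
      unfolding psubst_sum psubst_mult psubst_Var by (rule sum.cong) auto
    with b show ?thesis by (simp add: Bop_def)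
  qed
  ultimately show ?thesis by (simp add: psubst_add psubst_mult)
qed

text \<open>The induction keeps the restricted vector in the form \<open>X' V_s\<close>, with block
  rows \<open>X V_s\<close> and \<open>A V_s\<close>, since \<open>X'Y'\<close> takes
  \<open>X' V\<close> to \<open>X' (YX + BA) V\<close>. The only deviation is the extra
  \<open>k q\<close> in component \<open>N + b\<close> at \<open>s = 0\<close>.\<close>

lemma slice_XYB:
  assumes f: "f \<in> Hspace n k (N + n)" and b: "b < n"
  defines "q \<equiv> psubst (slice N) f"
  shows "(\<forall>i<N. psubst (slice N) (XYB (N + n) s b f i) = Xmul N (sliced_XYB n k N b q s) i) \<and>
    (\<forall>c<n. psubst (slice N) (XYB (N + n) s b f (N + c)) =
      Amul N c (sliced_XYB n k N b q s) + (if s = 0 \<and> c = b then Const (of_nat k) * q else 0))"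
proof (induction s)
  case 0
  have *: "Xmul N (sliced_XYB n k N b q 0) i = Xmul N (\<lambda>m. Bop m b q) i"
    "Amul N c (sliced_XYB n k N b q 0) = Amul N c (\<lambda>m. Bop m b q)" for i c
    by (simp_all add: Xmul_def Amul_def XYB_0)
  show ?case
  proof (intro conjI allI impI)
    fix i assume i: "i < N"
    then show "psubst (slice N) (XYB (N + n) 0 b f i) = Xmul N (sliced_XYB n k N b q 0) i"
      unfolding * using slice_Bop[OF f b, of i] by (simp add: XYB_0 Xmul_def q_def)
  next
    fix c assume c: "c < n"
    show "psubst (slice N) (XYB (N + n) 0 b f (N + c)) = Amul N c (sliced_XYB n k N b q 0) +
        (if 0 = (0::nat) \<and> c = b then Const (of_nat k) * q else 0)"
      unfolding * using slice_Bop[OF f b, of "N + c"] c by (simp add: XYB_0 Amul_def q_def)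
  qed
next
  case (Suc s)
  let ?V = "sliced_XYB n k N b q"
  let ?U = "shifted_XYB n k N b q"
  define W where "W m = divvec N (\<lambda>l. psubst (slice N) (XYB (N + n) s b f l)) m +
      (\<Sum>c<n. pderiv_var (AV c m) (psubst (slice N) (XYB (N + n) s b f (N + c))))" for m
  have qH: "q \<in> Hspace n k N" unfolding q_def by (rule Hspace_slice[OF f])
  have eq: "psubst (slice N) (XYB (N + n) (Suc s) b f i) = (\<Sum>m<N. slice N (XV i m) * W m)" for i
    unfolding XYB_Suc slice_Xmul_divvec W_def ..
  \<comment> \<open>By \<open>YX_BA_eqvec\<close> the operator is \<open>XY + k + n\<close>. It is
    linear and advances every \<open>shifted_XYB\<close> by one step, hence both summands of
    \<open>V_s\<close>. At \<open>s = 0\<close> the second summand of \<open>V_1\<close> comes from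
    differentiating the extra \<open>k q\<close>.\<close>
  have W: "W m = ?V (Suc s) m" if m: "m < N" for m
  proof -
    have "(\<Sum>c<n. pderiv_var (AV c m) (psubst (slice N) (XYB (N + n) s b f (N + c)))) =
      (\<Sum>c<n. pderiv_var (AV c m) (Amul N c (?V s)) +
        (if c = b then if s = 0 then Const (of_nat k) * pderiv_var (AV c m) q else 0 else 0))"
      by (rule sum.cong) (use Suc in \<open>auto simp: pderiv_var_add pderiv_var_Const_mult\<close>)
    also have "\<dots> = (\<Sum>c<n. pderiv_var (AV c m) (Amul N c (?V s))) +
        (if s = 0 then Const (of_nat k) * Bop m b q else 0)"
      using b by (simp add: sum.distrib Bop_def)
    finally have "W m = (divvec N (Xmul N (?V s)) m + (\<Sum>c<n. pderiv_var (AV c m) (Amul N c (?V s)))) +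
        (if s = 0 then Const (of_nat k) * Bop m b q else 0)"
      unfolding W_def using divvec_cong[of N "\<lambda>l. psubst (slice N) (XYB (N + n) s b f l)" "Xmul N (?V s)"] Suc
      by (simp add: add.assoc)
    also have "\<dots> = Xmul N (divvec N (?V s)) m + Const (of_nat (k + n)) * ?V s m +
        (if s = 0 then Const (of_nat k) * Bop m b q else 0)"
      unfolding YX_BA_eqvec[OF eqvec_sliced_XYB[OF qH b] m] ..
    also have "\<dots> = ?V (Suc s) m"
    proof (cases s)
      case 0
      then show ?thesis using m by (simp add: XYB_0)
    next
      case (Suc s')
      then show ?thesis
        by (simp only: sliced_XYB.simps Xmul_divvec_linear shifted_XYB.simps) (simp add: algebra_simps)
    qed
    finally show ?thesis .
  qed
  have "psubst (slice N) (XYB (N + n) (Suc s) b f i) = (\<Sum>m<N. slice N (XV i m) * ?V (Suc s) m)" for i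
    unfolding eq by (rule sum.cong) (use W in \<open>auto simp only: lessThan_iff\<close>)
  then show ?case
    using slice_row_low[of _ N "?V (Suc s)"] slice_row_high[of N _ "?V (Suc s)"]
    by (simp del: sliced_XYB.simps slice.simps)
qed

text \<open>\<open>A' = (0 | 1)\<close> selects component \<open>N + a\<close> of the restricted
  vector.\<close>

lemma slice_AXYB:
  assumes f: "f \<in> Hspace n k (N + n)" and a: "a < n" and b: "b < n"
  shows "psubst (slice N) (AXYB (N + n) s a b f) = Amul N a (sliced_XYB n k N b (psubst (slice N) f) s) +
    (if s = 0 \<and> a = b then Const (of_nat k) * psubst (slice N) f else 0)"
proof -
  let ?F = "\<lambda>i. psubst (slice N) (XYB (N + n) s b f i)"
  have "(\<Sum>i<N. slice N (AV a i) * ?F i) = 0"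
    by (rule sum.neutral) auto
  moreover have "(\<Sum>l<n. slice N (AV a (N + l)) * ?F (N + l)) = (\<Sum>l<n. if l = a then ?F (N + l) else 0)"
    by (rule sum.cong) auto
  ultimately have "psubst (slice N) (AXYB (N + n) s a b f) = (\<Sum>l<n. if l = a then ?F (N + l) else 0)"
    unfolding AXYB_eq_Amul Amul_def sum_split_at psubst_add psubst_sum psubst_mult psubst_Var by simp
  also have "\<dots> = psubst (slice N) (XYB (N + n) s b f (N + a))"
    using a by simp
  finally show ?thesis using slice_XYB[OF f b, of s] a by simp
qed

section \<open>Generating functions\<close>

no_notation vec_index (infixl \<open>$\<close> 100)
unbundle fps_syntax

lemma inv_shift_mult: "inv_shift w * (1 + fps_const w * fps_X) = fps_X"
  by (simp add: inv_shift_def mult.assoc inverse_mult_eq_1)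

lemma inv_shift_nth_0 [simp]: "inv_shift w $ 0 = 0"
  by (simp add: inv_shift_def)

lemma inv_shift_nonzero: "inv_shift w \<noteq> 0"
  using inv_shift_mult[of w] by auto

text \<open>As \<open>inv_shift w\<close> expands \<open>1/(u + w)\<close>, this is the resolvent
  identity for scalars, proved by clearing two nonzero denominators.\<close>

lemma inv_shift_add: "inv_shift w * (1 - fps_const c * inv_shift (w + c)) = inv_shift (w + c)"
proof -
  let ?A = "1 + fps_const w * fps_X" and ?B = "1 + fps_const (w + c) * fps_X :: complex fps"
  have "?A \<noteq> 0" "?B \<noteq> 0"
    using inv_shift_mult[of w] inv_shift_mult[of "w + c"] by auto
  moreover have "inv_shift w * (1 - fps_const c * inv_shift (w + c)) * (?A * ?B) =
      (inv_shift w * ?A) * (?B - fps_const c * (inv_shift (w + c) * ?B))"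
    by (simp add: algebra_simps)
  moreover have "\<dots> = fps_X * ?A"
    unfolding inv_shift_mult by (simp add: algebra_simps fps_const_add[symmetric] del: fps_const_add)
  moreover have "\<dots> = (inv_shift (w + c) * ?B) * ?A"
    by (simp only: inv_shift_mult)
  moreover have "\<dots> = inv_shift (w + c) * (?A * ?B)"
    by (simp only: mult_ac)
  ultimately show ?thesis by (metis mult_cancel_right mult_eq_0_iff)
qed

lemma inv_shift_factor:
  "(1 + fps_const w * fps_X) * (1 + fps_const a * inv_shift w) = 1 + fps_const (a + w) * fps_X"
proof -
  have "(1 + fps_const w * fps_X) * (1 + fps_const a * inv_shift w) =
     1 + fps_const w * fps_X + fps_const a * (inv_shift w * (1 + fps_const w * fps_X))"
    by (simp only: distrib_left distrib_right mult_1_left mult_1_right ac_simps)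
  then show ?thesis
    unfolding inv_shift_mult by (simp add: algebra_simps fps_const_add[symmetric] del: fps_const_add)
qed

text \<open>With \<open>h i s = \<phi>(K\<^sup>i (K + c)\<^sup>s)\<close> for a linear functional \<open>\<phi>\<close> this is the identity
  \<open>1/(u + w + c - (K + c)) = 1/(u + w - K)\<close>.\<close>

lemma resolvent_shift:
  fixes h :: "nat \<Rightarrow> nat \<Rightarrow> complex"
  assumes h: "\<And>i s. h i (Suc s) = h (Suc i) s + c * h i s"
  shows "(fps_X * Abs_fps (h 0)) oo inv_shift (w + c) = (fps_X * Abs_fps (\<lambda>i. h i 0)) oo inv_shift w"
proof -
  let ?t = "inv_shift (w + c)" and ?s = "inv_shift w"
  \<comment> \<open>\<open>G i\<close> and \<open>F i\<close> are the two expansions with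
    \<open>K^i\<close> inserted. Both satisfy the recursion
    \<open>x i = ?s * (h i 0 + x (i + 1))\<close>.\<close>
  define G where "G i = (fps_X * Abs_fps (h i)) oo ?t" for i
  define F where "F i = (fps_X * Abs_fps (\<lambda>j. h (i + j) 0)) oo ?s" for i
  have G: "G i = ?s * (fps_const (h i 0) + G (Suc i))" for i
  proof -
    have "Abs_fps (h i) = fps_const (h i 0) + fps_X * Abs_fps (h (Suc i)) + fps_const c * (fps_X * Abs_fps (h i))"
    proof (rule fps_ext)
      fix m show "Abs_fps (h i) $ m =
        (fps_const (h i 0) + fps_X * Abs_fps (h (Suc i)) + fps_const c * (fps_X * Abs_fps (h i))) $ m"
        by (cases m) (simp_all add: h)
    qed
    then have "G i = (fps_X * (fps_const (h i 0) + fps_X * Abs_fps (h (Suc i)) + fps_const c * (fps_X * Abs_fps (h i)))) oo ?t"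
      unfolding G_def by simp
    also have "\<dots> = ?t * (fps_const (h i 0) + G (Suc i) + fps_const c * G i)"
      unfolding G_def by (simp add: fps_compose_mult_distrib[OF inv_shift_nth_0] fps_compose_add_distrib)
    finally have 1: "(1 - fps_const c * ?t) * G i = ?t * (fps_const (h i 0) + G (Suc i))"
      by (simp add: algebra_simps)
    have "?t * G i = ?s * ((1 - fps_const c * ?t) * G i)"
      by (simp only: mult.assoc[symmetric] inv_shift_add)
    also have "\<dots> = ?t * (?s * (fps_const (h i 0) + G (Suc i)))"
      unfolding 1 by (simp only: ac_simps)
    finally show ?thesis using inv_shift_nonzero[of "w + c"] by simp
  qed
  have F: "F i = ?s * (fps_const (h i 0) + F (Suc i))" for i
  proof -
    have "Abs_fps (\<lambda>j. h (i + j) 0) = fps_const (h i 0) + fps_X * Abs_fps (\<lambda>j. h (Suc i + j) 0)"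
    proof (rule fps_ext)
      fix m show "Abs_fps (\<lambda>j. h (i + j) 0) $ m =
          (fps_const (h i 0) + fps_X * Abs_fps (\<lambda>j. h (Suc i + j) 0)) $ m"
        by (cases m) simp_all
    qed
    then show ?thesis
      unfolding F_def by (simp add: fps_compose_mult_distrib[OF inv_shift_nth_0] fps_compose_add_distrib)
  qed
  have D: "G i - F i = ?s * (G (Suc i) - F (Suc i))" for i
    by (subst G, subst F) (simp add: algebra_simps)
  \<comment> \<open>\<open>?s\<close> has no constant term, so each coefficient of a difference
    depends only on lower coefficients of the next difference. The induction on \<open>r\<close>
    treats all \<open>i\<close> at once.\<close>
  have "(G i - F i) $ r = 0" for i r
  proof (induction r arbitrary: i rule: less_induct)
    case (less r)
    have "(?s * (G (Suc i) - F (Suc i))) $ r = 0"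
      unfolding fps_mult_nth
    proof (rule sum.neutral, rule ballI)
      fix j assume "j \<in> {0..r}"
      then show "?s $ j * (G (Suc i) - F (Suc i)) $ (r - j) = 0"
        using less[of "r - j" "Suc i"] by (cases "j = 0") auto
    qed
    then show ?case unfolding D[of i] .
  qed
  then have "G 0 = F 0" by (intro fps_ext) simp
  then show ?thesis by (simp add: G_def F_def)
qed

section \<open>Coefficients of \<open>T(u)\<close> as composed power series\<close>

lemma lookup_Const_mult: "Poly_Mapping.lookup (Const c * f) m = c * Poly_Mapping.lookup f m"
proof -
  have "Const c * f = (\<Sum>m\<in>Poly_Mapping.keys f. Poly_Mapping.single m (c * Poly_Mapping.lookup f m))"
    by (subst (1) cpoly_monomials[symmetric]) (simp add: Const_def sum_distrib_left mult_single)
  then show ?thesis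
    by (simp add: lookup_sum lookup_single when_def in_keys_iff)
qed

text \<open>The shape of \<open>Tcoeff\<close> with prefactor, expansion variable and polynomials as
  parameters. A substitution acts on \<open>g\<close> and \<open>D\<close> only, and each monomial
  leaves a complex power series.\<close>

definition Tseries :: "complex fps \<Rightarrow> complex fps \<Rightarrow> bool \<Rightarrow> cpoly \<Rightarrow> (nat \<Rightarrow> cpoly) \<Rightarrow> nat \<Rightarrow> cpoly" where
  "Tseries P t d g D r = (\<Sum>i\<le>r. Const (P $ i) * ((if r - i = 0 \<and> d then g else 0) +
     (\<Sum>s<r - i. Const (t ^ (s + 1) $ (r - i)) * D s)))"

lemma lookup_Tseries:
  "Poly_Mapping.lookup (Tseries P t d g D r) m = (P * (fps_const (of_bool d * Poly_Mapping.lookup g m) +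
     ((fps_X * Abs_fps (\<lambda>s. Poly_Mapping.lookup (D s) m)) oo t))) $ r"
proof -
  have "((fps_X * Abs_fps (\<lambda>s. Poly_Mapping.lookup (D s) m)) oo t) $ j =
      (\<Sum>s<j. t ^ (s + 1) $ j * Poly_Mapping.lookup (D s) m)" for j
  proof -
    \<comment> \<open>The composition index is \<open>s + 1\<close>; index \<open>0\<close>
      contributes nothing because of the factor \<open>fps_X\<close>.\<close>
    have "((fps_X * Abs_fps (\<lambda>s. Poly_Mapping.lookup (D s) m)) oo t) $ j =
       (\<Sum>i\<in>Suc ` {..<j}. (fps_X * Abs_fps (\<lambda>s. Poly_Mapping.lookup (D s) m)) $ i * t ^ i $ j)"
      unfolding fps_compose_nth
    proof (rule sum.mono_neutral_right)
      show "\<forall>i\<in>{0..j} - Suc ` {..<j}. (fps_X * Abs_fps (\<lambda>s. Poly_Mapping.lookup (D s) m)) $ i * t ^ i $ j = 0"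
      proof
        fix i assume "i \<in> {0..j} - Suc ` {..<j}"
        then have "i = 0" by (cases i) auto
        then show "(fps_X * Abs_fps (\<lambda>s. Poly_Mapping.lookup (D s) m)) $ i * t ^ i $ j = 0" by simp
      qed
    qed auto
    also have "\<dots> = (\<Sum>s<j. t ^ (s + 1) $ j * Poly_Mapping.lookup (D s) m)"
      by (subst sum.reindex) (auto simp: mult.commute)
    finally show ?thesis .
  qed
  then show ?thesis
    by (simp add: Tseries_def lookup_sum lookup_Const_mult lookup_add fps_mult_nth atMost_atLeast0
        if_distrib[of "\<lambda>p. Poly_Mapping.lookup p m"] of_bool_def cong: if_cong)
qed

lemma Tcoeff_eq_Tseries:
  "Tcoeff n k L N a b r f =
    Tseries (prefactor n k L) (inv_shift (of_nat ((k + n) * L))) (a = b) f (\<lambda>s. AXYB N s a b f) r"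
  by (simp add: Tcoeff_def Tbracket_def Tseries_def)

lemma psubst_Tseries: "psubst s (Tseries P t d g D r) = Tseries P t d (psubst s g) (\<lambda>j. psubst s (D j)) r"
  by (simp add: Tseries_def psubst_sum psubst_mult psubst_add if_distrib[of "psubst s"] cong: if_cong)

text \<open>The new factor is \<open>(u + c)/(u + k + c)\<close> with
  \<open>c = (k + n)(L + 1)\<close>; here its denominator is cleared.\<close>

lemma prefactor_Suc:
  "prefactor n k (Suc L) * (1 + fps_const (of_nat k + of_nat ((k + n) * Suc L)) * fps_X) =
   prefactor n k L * (1 + fps_const (of_nat ((k + n) * Suc L)) * fps_X)"
proof -
  have "inverse (1 + fps_const (of_nat (k + (n + k) * Suc L)) * fps_X) *
      (1 + fps_const (of_nat k + of_nat ((k + n) * Suc L)) * fps_X) = (1 :: complex fps)"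
    by (subst of_nat_add, subst add.commute[of n], rule inverse_mult_eq_1) simp
  then show ?thesis
    unfolding prefactor_def by (simp add: mult.assoc add.commute[of n] del: mult_Suc_right)
qed

lemma slice_Tcoeff:
  assumes f: "f \<in> Hspace n k (N + n)" and a: "a < n" and b: "b < n"
  shows "psubst (slice N) (Tcoeff n k (Suc L) (N + n) a b r f) = Tcoeff n k L N a b r (psubst (slice N) f)"
proof (rule poly_mapping_eqI)
  fix m
  define q where "q = psubst (slice N) f"
  let ?c = "of_nat (k + n) :: complex"
  define op where "op F = Xmul N (divvec N F)" for F
  let ?U = "shifted_XYB n k N b q"
  \<comment> \<open>With \<open>K = XY\<close> this is the coefficient at \<open>m\<close> of
    \<open>A^a K^i (K + k + n)^s B_b q\<close>, the double sequence to which
    \<open>resolvent_shift\<close> applies.\<close>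
  define h where "h i s = Poly_Mapping.lookup (Amul N a ((op ^^ i) (?U s))) m" for i s
  define x where "x = of_bool (a = b) * Poly_Mapping.lookup q m"
  define e where "e s = Poly_Mapping.lookup (psubst (slice N) (AXYB (N + n) s a b f)) m" for s
  define w where "w = (of_nat ((k + n) * L) :: complex)"
  have w: "of_nat ((k + n) * Suc L) = w + ?c" by (simp add: w_def algebra_simps)
  have lin: "(op ^^ i) (\<lambda>j. F j + Const d * G j) = (\<lambda>j. (op ^^ i) F j + Const d * (op ^^ i) G j)" for i d F G
    by (induction i) (simp_all add: op_def Xmul_divvec_linear)
  have U: "?U (Suc s) = (\<lambda>i. op (?U s) i + Const ?c * ?U s i)" for s
    by (simp add: op_def)
  have h: "h i (Suc s) = h (Suc i) s + ?c * h i s" for i s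
    unfolding h_def U lin Amul_linear lookup_add lookup_Const_mult
    by (simp add: funpow_swap1 del: of_nat_add)
  have "(op ^^ i) (?U 0) = XYB N i b q" for i
  proof (induction i)
    case (Suc i)
    have "XYB N (Suc i) b q = op (XYB N i b q)" unfolding op_def by (rule ext) (rule XYB_Suc)
    with Suc show ?case by simp
  qed simp
  then have h0: "h i 0 = Poly_Mapping.lookup (AXYB N i a b q) m" for i
    by (simp add: h_def AXYB_eq_Amul)
  \<comment> \<open>The second summand of \<open>V_s\<close> and the term \<open>k q\<close> at
    \<open>s = 0\<close> follow one pattern: \<open>x\<close> plays the part of \<open>h 0\<close>
    at index \<open>-1\<close>.\<close>
  have e: "e s = h 0 s + (case s of 0 \<Rightarrow> of_nat k * x | Suc s' \<Rightarrow> of_nat k * h 0 s')" for s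
    unfolding e_def slice_AXYB[OF f a b] q_def[symmetric] h_def x_def
    by (cases s) (simp_all add: lookup_add lookup_Const_mult Amul_linear del: shifted_XYB.simps)
  have "fps_X * Abs_fps e = (1 + fps_const (of_nat k) * fps_X) * (fps_X * Abs_fps (h 0)) +
      fps_const (of_nat k * x) * fps_X"
  proof -
    have "Abs_fps e = (1 + fps_const (of_nat k) * fps_X) * Abs_fps (h 0) + fps_const (of_nat k * x)"
    proof (rule fps_ext)
      fix j show "Abs_fps e $ j = ((1 + fps_const (of_nat k) * fps_X) * Abs_fps (h 0) + fps_const (of_nat k * x)) $ j"
        by (cases j) (simp_all add: e distrib_right mult.assoc)
    qed
    then show ?thesis by (simp only:) (simp add: algebra_simps)
  qed
  then have E: "(fps_X * Abs_fps e) oo inv_shift (w + ?c) =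
      (1 + fps_const (of_nat k) * inv_shift (w + ?c)) * ((fps_X * Abs_fps (h 0)) oo inv_shift (w + ?c)) +
      fps_const (of_nat k * x) * inv_shift (w + ?c)"
    by (simp add: fps_compose_mult_distrib[OF inv_shift_nth_0] fps_compose_add_distrib)
  let ?D = "(fps_X * Abs_fps (\<lambda>i. h i 0)) oo inv_shift w"
  \<comment> \<open>Hence \<open>1 + k/(u + w + ?c)\<close> splits off as a common factor, and by
    \<open>resolvent_shift\<close> the remaining series is the one for size \<open>N\<close> with
    parameter \<open>w\<close>.\<close>
  have main: "fps_const x + ((fps_X * Abs_fps e) oo inv_shift (w + ?c)) =
      (1 + fps_const (of_nat k) * inv_shift (w + ?c)) * (fps_const x + ?D)"
    unfolding E resolvent_shift[of h, OF h]
    by (simp add: algebra_simps fps_const_mult[symmetric] del: fps_const_mult)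
  define B where "B = 1 + fps_const (of_nat k + (w + ?c)) * fps_X"
  define W where "W = 1 + fps_const (w + ?c) * fps_X"
  define E' where "E' = fps_const x + ((fps_X * Abs_fps e) oo inv_shift (w + ?c))"
  define D' where "D' = fps_const x + ?D"
  have E': "E' = (1 + fps_const (of_nat k) * inv_shift (w + ?c)) * D'"
    and B: "W * (1 + fps_const (of_nat k) * inv_shift (w + ?c)) = B"
    and P: "prefactor n k (Suc L) * B = prefactor n k L * W"
    unfolding E'_def D'_def B_def W_def
    by (rule main, rule inv_shift_factor, rule prefactor_Suc[of n k L, unfolded w])
  \<comment> \<open>\<open>E'\<close> is \<open>D'\<close> times \<open>B/W\<close>, while passing
    from \<open>L\<close> to \<open>L + 1\<close> multiplies the prefactor by \<open>W/B\<close>, so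
    the product is unchanged.\<close>
  have "prefactor n k (Suc L) * E' * B = prefactor n k (Suc L) * B * E'"
    by (simp only: mult_ac)
  also have "\<dots> = prefactor n k L * (W * (1 + fps_const (of_nat k) * inv_shift (w + ?c))) * D'"
    unfolding P E' by (simp only: mult_ac)
  also have "\<dots> = prefactor n k L * D' * B"
    unfolding B by (simp only: mult_ac)
  finally have "prefactor n k (Suc L) * E' * B = prefactor n k L * D' * B" .
  moreover have "fps_nth B 0 = 1" by (simp add: B_def)
  then have "B \<noteq> 0" by auto
  ultimately have "prefactor n k (Suc L) * E' = prefactor n k L * D'" by simp
  then show "Poly_Mapping.lookup (psubst (slice N) (Tcoeff n k (Suc L) (N + n) a b r f)) m =
      Poly_Mapping.lookup (Tcoeff n k L N a b r (psubst (slice N) f)) m"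
    unfolding Tcoeff_eq_Tseries psubst_Tseries lookup_Tseries w q_def[symmetric] x_def[symmetric]
      e_def[symmetric] h0[symmetric] w_def[symmetric] E'_def D'_def by simp
qed

section \<open>Adjoints and the section \<open>\<sigma>\<^sub>N\<close>\<close>

lemma XYop_polyring:
  assumes "f \<in> polyring n N" "i < N"
  shows "XYop N i j f \<in> polyring n N"
  unfolding XYop_def Yop_def using assms
  by (intro polyring_sum polyring_mult polyring_Var polyring_pderiv_var) simp_all

lemma XYpow_polyring:
  assumes "f \<in> polyring n N" "i < N"
  shows "XYpow N s i j f \<in> polyring n N"
  using assms(2) by (induction s arbitrary: i) (auto simp: assms(1) intro!: polyring_sum XYop_polyring)

lemma XYop_0 [simp]: "XYop N i j 0 = 0"
  by (simp add: XYop_def Yop_def)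

text \<open>Adjoints reverse products, so the power must also be unfolded from the right.\<close>

lemma XYpow_Suc_right:
  assumes "i < N" "j < N"
  shows "XYpow N (Suc s) i j f = (\<Sum>l<N. XYpow N s i l (XYop N l j f))"
  using assms(1)
proof (induction s arbitrary: i)
  case 0
  have "XYpow N (Suc 0) i j f = (\<Sum>l<N. if l = j then XYop N i l f else 0)"
    unfolding XYpow.simps by (rule sum.cong) auto
  also have "\<dots> = XYop N i j f" using assms by simp
  also have "\<dots> = (\<Sum>l<N. XYpow N 0 i l (XYop N l j f))" using 0 by simp
  finally show ?case .
next
  case (Suc s)
  have "XYpow N (Suc (Suc s)) i j f = (\<Sum>l<N. XYop N i l (XYpow N (Suc s) l j f))"
    by (rule XYpow.simps)
  also have "\<dots> = (\<Sum>l<N. XYop N i l (\<Sum>m<N. XYpow N s l m (XYop N m j f)))"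
    by (rule sum.cong) (use Suc.IH in auto)
  also have "\<dots> = (\<Sum>m<N. \<Sum>l<N. XYop N i l (XYpow N s l m (XYop N m j f)))"
    unfolding XYop_sum by (rule sum.swap)
  also have "\<dots> = (\<Sum>m<N. XYpow N (Suc s) i m (XYop N m j f))"
    by (simp only: XYpow.simps(2))
  finally show ?case .
qed

context
  fixes n N :: nat and ip
  assumes fock: "fock_inner n N ip"
begin

lemma ip_add_left:
  "f \<in> polyring n N \<Longrightarrow> g \<in> polyring n N \<Longrightarrow> h \<in> polyring n N \<Longrightarrow> ip (f + g) h = ip f h + ip g h"
  using fock unfolding fock_inner_def by blast

lemma ip_Const_left: "f \<in> polyring n N \<Longrightarrow> g \<in> polyring n N \<Longrightarrow> ip (Const c * f) g = c * ip f g"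
  using fock unfolding fock_inner_def by blast

lemma ip_cnj: "f \<in> polyring n N \<Longrightarrow> g \<in> polyring n N \<Longrightarrow> ip g f = cnj (ip f g)"
  using fock unfolding fock_inner_def by blast

lemma ip_definite: "f \<in> polyring n N \<Longrightarrow> ip f f = 0 \<Longrightarrow> f = 0"
proof (rule ccontr)
  assume f: "f \<in> polyring n N" and "ip f f = 0" "f \<noteq> 0"
  have "\<forall>f\<in>polyring n N. f \<noteq> 0 \<longrightarrow> 0 < Re (ip f f)"
    using fock unfolding fock_inner_def by (elim conjE)
  with f \<open>f \<noteq> 0\<close> \<open>ip f f = 0\<close> show False by (metis less_irrefl zero_complex.sel(1))
qed

lemma ip_Var_left:
  "v \<in> mvars n N \<Longrightarrow> f \<in> polyring n N \<Longrightarrow> g \<in> polyring n N \<Longrightarrow> ip (Var v * f) g = ip f (pderiv_var v g)"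
  using fock unfolding fock_inner_def by blast

lemma ip_0_left: "g \<in> polyring n N \<Longrightarrow> ip 0 g = 0"
  using ip_Const_left[of 0 g 0] by simp

lemma ip_sum_left:
  assumes "\<And>x. x \<in> S \<Longrightarrow> F x \<in> polyring n N" "g \<in> polyring n N"
  shows "ip (\<Sum>x\<in>S. F x) g = (\<Sum>x\<in>S. ip (F x) g)"
  using assms(1)
  by (induction S rule: infinite_finite_induct) (simp_all add: ip_0_left ip_add_left assms(2))

lemma ip_sum_right:
  assumes "\<And>x. x \<in> S \<Longrightarrow> F x \<in> polyring n N" "g \<in> polyring n N"
  shows "ip g (\<Sum>x\<in>S. F x) = (\<Sum>x\<in>S. ip g (F x))"
proof -
  have "ip g (\<Sum>x\<in>S. F x) = cnj (ip (\<Sum>x\<in>S. F x) g)"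
    using assms by (intro ip_cnj polyring_sum)
  also have "\<dots> = (\<Sum>x\<in>S. cnj (ip (F x) g))"
    by (simp add: ip_sum_left assms)
  also have "\<dots> = (\<Sum>x\<in>S. ip g (F x))"
    by (intro sum.cong refl ip_cnj[symmetric] assms)
  finally show ?thesis .
qed

lemma ip_pderiv_left:
  assumes "v \<in> mvars n N" "f \<in> polyring n N" "g \<in> polyring n N"
  shows "ip (pderiv_var v f) g = ip f (Var v * g)"
  using ip_cnj[of g "pderiv_var v f"] ip_cnj[of "Var v * g" f] ip_Var_left[of v g f] assms by simp

text \<open>The adjoint of multiplication by one variable after differentiation in another has the
  two variables exchanged; in \<open>XYop\<close> this exchanges the row indices.\<close>

lemma ip_XYop:
  assumes f: "f \<in> polyring n N" and g: "g \<in> polyring n N" and ij: "i < N" "j < N"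
  shows "ip (XYop N i j f) g = ip f (XYop N j i g)"
proof -
  have "ip (XYop N i j f) g = (\<Sum>l<N. ip (Var (XV i l) * pderiv_var (XV j l) f) g)"
    unfolding XYop_def Yop_def using f g ij by (intro ip_sum_left polyring_mult polyring_Var) simp_all
  also have "\<dots> = (\<Sum>l<N. ip f (Var (XV j l) * pderiv_var (XV i l) g))"
    using f g ij by (simp add: ip_Var_left ip_pderiv_left)
  also have "\<dots> = ip f (XYop N j i g)"
    unfolding XYop_def Yop_def using f g ij
    by (intro ip_sum_right[symmetric] polyring_mult polyring_Var) simp_all
  finally show ?thesis .
qed

lemma ip_XYpow:
  assumes f: "f \<in> polyring n N" and "g \<in> polyring n N" "i < N" and j: "j < N"
  shows "ip (XYpow N s i j f) g = ip f (XYpow N s j i g)"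
  using assms(2,3)
proof (induction s arbitrary: i g)
  case 0
  then show ?case using ip_0_left[of g] ip_cnj[of 0 f] ip_0_left[of f] f by auto
next
  case (Suc s)
  have "ip (XYpow N (Suc s) i j f) g = (\<Sum>l<N. ip (XYop N i l (XYpow N s l j f)) g)"
    unfolding XYpow.simps using Suc.prems f by (intro ip_sum_left XYop_polyring XYpow_polyring) auto
  also have "\<dots> = (\<Sum>l<N. ip f (XYpow N s j l (XYop N l i g)))"
    by (rule sum.cong) (use Suc f in \<open>auto simp: ip_XYop XYpow_polyring XYop_polyring\<close>)
  also have "\<dots> = ip f (\<Sum>l<N. XYpow N s j l (XYop N l i g))"
    using Suc.prems f j by (intro ip_sum_right[symmetric] XYop_polyring XYpow_polyring) auto
  also have "\<dots> = ip f (XYpow N (Suc s) j i g)"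
    by (simp only: XYpow_Suc_right[OF j Suc.prems(2)])
  finally show ?case .
qed

text \<open>With \<open>P = (XY)^s\<close> the adjoint of \<open>A^a_i P^i_j B^j_b\<close> is
  \<open>A^b_j P^j_i B^i_a\<close>: reversed order and transposed indices give an operator of the
  same kind.\<close>

lemma ip_AXYB:
  assumes f: "f \<in> polyring n N" and g: "g \<in> polyring n N" and ab: "a < n" "b < n"
  shows "ip (AXYB N s a b f) g = ip f (AXYB N s b a g)"
proof -
  have "ip (AXYB N s a b f) g = (\<Sum>i<N. ip (\<Sum>j<N. Var (AV a i) * XYpow N s i j (Bop j b f)) g)"
    unfolding AXYB_def Bop_def using f g ab
    by (intro ip_sum_left polyring_sum polyring_mult polyring_Var XYpow_polyring polyring_pderiv_var) simp_all
  also have "\<dots> = (\<Sum>i<N. \<Sum>j<N. ip (Var (AV a i) * XYpow N s i j (Bop j b f)) g)"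
    unfolding Bop_def using f g ab
    by (intro sum.cong refl ip_sum_left polyring_mult polyring_Var XYpow_polyring polyring_pderiv_var) simp_all
  also have "\<dots> = (\<Sum>i<N. \<Sum>j<N. ip f (Var (AV b j) * XYpow N s j i (Bop i a g)))"
    by (intro sum.cong refl)
      (use f g ab in \<open>simp add: Bop_def ip_Var_left ip_pderiv_left ip_XYpow XYpow_polyring\<close>)
  also have "\<dots> = (\<Sum>j<N. \<Sum>i<N. ip f (Var (AV b j) * XYpow N s j i (Bop i a g)))"
    by (rule sum.swap)
  also have "\<dots> = (\<Sum>j<N. ip f (\<Sum>i<N. Var (AV b j) * XYpow N s j i (Bop i a g)))"
    unfolding Bop_def using f g ab
    by (intro sum.cong refl ip_sum_right[symmetric] polyring_mult polyring_Var XYpow_polyring polyring_pderiv_var) simp_all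
  also have "\<dots> = ip f (AXYB N s b a g)"
    unfolding AXYB_def Bop_def using f g ab
    by (intro ip_sum_right[symmetric] polyring_sum polyring_mult polyring_Var XYpow_polyring polyring_pderiv_var) simp_all
  finally show ?thesis .
qed

end

section \<open>The kernel of \<open>p_N\<close> and its orthogonal complement\<close>

lemma pmap_add:
  "f \<in> Hspace n k (N + n) \<Longrightarrow> g \<in> Hspace n k (N + n) \<Longrightarrow>
    pmap n k N (f + g) = pmap n k N f + pmap n k N g"
  by (simp add: pmap_eq_slice Hspace_add psubst_add)

lemma pmap_Const_mult:
  "f \<in> Hspace n k (N + n) \<Longrightarrow> pmap n k N (Const c * f) = Const c * pmap n k N f"
  by (simp add: pmap_eq_slice Hspace_Const_mult psubst_mult)

lemma pmap_Tcoeff: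
  assumes "f \<in> Hspace n k (N + n)" "a < n" "b < n"
  shows "pmap n k N (Tcoeff n k (L + 1) (N + n) a b r f) = Tcoeff n k L N a b r (pmap n k N f)"
  using slice_Tcoeff[OF assms] by (simp add: pmap_eq_slice Hspace_Tcoeff assms)

text \<open>By \<open>slice_AXYB\<close> the restriction of the image depends on \<open>h\<close>
  only through the restriction of \<open>h\<close>, which is zero here.\<close>

lemma pker_AXYB:
  assumes h: "h \<in> pker n k N" and ab: "a < n" "b < n"
  shows "AXYB (N + n) s a b h \<in> pker n k N"
proof -
  have hH: "h \<in> Hspace n k (N + n)" using h by (simp add: pker_def)
  have h0: "psubst (slice N) h = 0" using h by (simp add: pker_def pmap_eq_slice[OF hH])
  have XYB0: "XYB N 0 b 0 = (\<lambda>i. 0)"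
    by (auto simp: XYB_def Bop_def)
  have z: "shifted_XYB n k N b 0 s i = 0" for s i
    by (induction s arbitrary: i) (simp_all add: XYB0 Xmul_def divvec_def)
  have "sliced_XYB n k N b 0 s i = 0" for i
    by (cases s) (simp_all add: z del: shifted_XYB.simps)
  then have "psubst (slice N) (AXYB (N + n) s a b h) = 0"
    unfolding slice_AXYB[OF hH ab] h0 by (simp add: Amul_def)
  then show ?thesis
    using Hspace_AXYB[OF hH ab] by (simp add: pker_def pmap_eq_slice)
qed

context
  fixes n k N :: nat and ip
  assumes fock: "fock_inner n (N + n) ip"
begin

lemma pker_perp_polyring: "f \<in> pker_perp ip n k N \<Longrightarrow> f \<in> polyring n (N + n)"
  unfolding pker_perp_def by (blast intro: Hspace_polyring)

lemma pker_polyring: "f \<in> pker n k N \<Longrightarrow> f \<in> polyring n (N + n)"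
  unfolding pker_def by (blast intro: Hspace_polyring)

lemma pker_perpD:
  assumes "f \<in> pker_perp ip n k N"
  shows "f \<in> Hspace n k (N + n)" "h \<in> pker n k N \<Longrightarrow> ip f h = 0"
  using assms by (simp_all add: pker_perp_def)

lemma pker_perp_add:
  assumes f: "f \<in> pker_perp ip n k N" and g: "g \<in> pker_perp ip n k N"
  shows "f + g \<in> pker_perp ip n k N"
  unfolding pker_perp_def mem_Collect_eq
proof (intro conjI ballI Hspace_add pker_perpD(1) f g)
  fix h assume h: "h \<in> pker n k N"
  show "ip (f + g) h = 0"
    using ip_add_left[OF fock pker_perp_polyring[OF f] pker_perp_polyring[OF g] pker_polyring[OF h]]
      pker_perpD(2)[OF f h] pker_perpD(2)[OF g h] by simp
qed

lemma pker_perp_Const_mult: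
  assumes f: "f \<in> pker_perp ip n k N"
  shows "Const c * f \<in> pker_perp ip n k N"
  unfolding pker_perp_def mem_Collect_eq
proof (intro conjI ballI Hspace_Const_mult pker_perpD(1) f)
  fix h assume h: "h \<in> pker n k N"
  show "ip (Const c * f) h = 0"
    using ip_Const_left[OF fock pker_perp_polyring[OF f] pker_polyring[OF h]] pker_perpD(2)[OF f h] by simp
qed

lemma pker_perp_zero: "0 \<in> pker_perp ip n k N"
  unfolding pker_perp_def mem_Collect_eq
  by (intro conjI ballI Hspace_zero ip_0_left[OF fock] pker_polyring)

lemma pker_perp_sum: "(\<And>x. x \<in> S \<Longrightarrow> F x \<in> pker_perp ip n k N) \<Longrightarrow> (\<Sum>x\<in>S. F x) \<in> pker_perp ip n k N"
  by (induction S rule: infinite_finite_induct) (simp_all add: pker_perp_zero pker_perp_add)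

lemma pker_perp_AXYB:
  assumes f: "f \<in> pker_perp ip n k N" and ab: "a < n" "b < n"
  shows "AXYB (N + n) s a b f \<in> pker_perp ip n k N"
  unfolding pker_perp_def mem_Collect_eq
proof (intro conjI ballI)
  show "AXYB (N + n) s a b f \<in> Hspace n k (N + n)"
    using f ab by (simp add: pker_perp_def Hspace_AXYB)
  fix h assume h: "h \<in> pker n k N"
  have "ip (AXYB (N + n) s a b f) h = ip f (AXYB (N + n) s b a h)"
    by (rule ip_AXYB[OF fock pker_perp_polyring[OF f] pker_polyring[OF h] ab])
  also have "\<dots> = 0"
    using f pker_AXYB[OF h ab(2,1)] by (simp add: pker_perp_def)
  finally show "ip (AXYB (N + n) s a b f) h = 0" .
qed

lemma pker_perp_Tcoeff:
  assumes "f \<in> pker_perp ip n k N" "a < n" "b < n"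
  shows "Tcoeff n k L (N + n) a b r f \<in> pker_perp ip n k N"
  unfolding Tcoeff_def Tbracket_def using assms
  by (intro pker_perp_sum pker_perp_Const_mult pker_perp_add pker_perp_AXYB) (auto simp: pker_perp_zero)

text \<open>The difference lies in the kernel and in its complement, hence is orthogonal to
  itself.\<close>

lemma pmap_inj_on_perp:
  assumes f: "f \<in> pker_perp ip n k N" and g: "g \<in> pker_perp ip n k N"
    and eq: "pmap n k N f = pmap n k N g"
  shows "f = g"
proof -
  define z where "z = f + Const (-1) * g"
  have z: "z \<in> pker_perp ip n k N"
    unfolding z_def by (intro pker_perp_add pker_perp_Const_mult f g)
  have "pmap n k N z = pmap n k N g + Const (-1) * pmap n k N g"
    unfolding z_def using f g eq
    by (simp add: pker_perp_def pmap_add pmap_Const_mult Hspace_Const_mult)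
  also have "\<dots> = 0" by (rule ev_inject) simp
  finally have "z \<in> pker n k N" using z by (simp add: pker_def pker_perp_def)
  then have "ip z z = 0" using z by (simp add: pker_perp_def)
  then have "z = 0" by (rule ip_definite[OF fock pker_perp_polyring[OF z]])
  moreover have "f = z + g" unfolding z_def by (rule ev_inject) simp
  ultimately show ?thesis by simp
qed

text \<open>Both sides of each identity lie in the complement of the kernel, so they may be compared
  after \<open>p_N\<close>, which undoes \<sigma>. Linearity of \<sigma> is obtained in the same
  way.\<close>

lemma perp_section_hom:
  assumes \<sigma>: "perp_section ip n k N \<sigma>"
  shows "yangian_hom n (Hspace n k N) (Tcoeff n k L N)
    (Hspace n k (N + n)) (Tcoeff n k (L + 1) (N + n)) \<sigma>"
proof -
  have p\<sigma>: "pmap n k N (\<sigma> f) = f" if "f \<in> Hspace n k N" for f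
    using \<sigma> that by (simp add: perp_section_def)
  have perp: "\<sigma> f \<in> pker_perp ip n k N" if "f \<in> Hspace n k N" for f
    using \<sigma> that by (auto simp: perp_section_def)
  have H: "\<sigma> f \<in> Hspace n k (N + n)" if "f \<in> Hspace n k N" for f
    using perp[OF that] by (simp add: pker_perp_def)
  show ?thesis
    unfolding yangian_hom_def
  proof (intro conjI ballI allI impI)
    show "\<sigma> \<in> Hspace n k N \<rightarrow> Hspace n k (N + n)" using H by auto
  next
    fix f g assume f: "f \<in> Hspace n k N" and g: "g \<in> Hspace n k N"
    show "\<sigma> (f + g) = \<sigma> f + \<sigma> g"
      by (rule pmap_inj_on_perp)
        (simp_all add: f g p\<sigma> perp H Hspace_add pker_perp_add pmap_add)
  next
    fix c f assume f: "f \<in> Hspace n k N"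
    show "\<sigma> (Const c * f) = Const c * \<sigma> f"
      by (rule pmap_inj_on_perp)
        (simp_all add: f p\<sigma> perp H Hspace_Const_mult pker_perp_Const_mult pmap_Const_mult)
  next
    fix a b r f assume ab: "a < n" "b < n" and f: "f \<in> Hspace n k N"
    show "\<sigma> (Tcoeff n k L N a b r f) = Tcoeff n k (L + 1) (N + n) a b r (\<sigma> f)"
    proof (rule pmap_inj_on_perp)
      show "pmap n k N (\<sigma> (Tcoeff n k L N a b r f)) = pmap n k N (Tcoeff n k (L + 1) (N + n) a b r (\<sigma> f))"
        unfolding pmap_Tcoeff[OF H[OF f] ab] p\<sigma>[OF Hspace_Tcoeff[OF f ab]] p\<sigma>[OF f] ..
    qed (intro perp Hspace_Tcoeff pker_perp_Tcoeff f ab)+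
  qed
qed

end

theorem theorem8p4:
  fixes N n k L :: nat
  assumes "N \<ge> 1" and "n \<ge> 1" and "k \<ge> 1" and "L = N div n"
  shows "yangian_hom n (Hspace n k (N + n)) (Tcoeff n k (L + 1) (N + n))
                       (Hspace n k N) (Tcoeff n k L N) (pmap n k N) \<and>
         (\<forall>ip \<sigma>. fock_inner n (N + n) ip \<and> perp_section ip n k N \<sigma> \<longrightarrow>
            yangian_hom n (Hspace n k N) (Tcoeff n k L N)
                          (Hspace n k (N + n)) (Tcoeff n k (L + 1) (N + n)) \<sigma>)"
proof (intro conjI allI impI)
  have "pmap n k N f \<in> Hspace n k N" if "f \<in> Hspace n k (N + n)" for f
    using Hspace_slice[OF that] by (simp add: pmap_eq_slice[OF that])
  then show "yangian_hom n (Hspace n k (N + n)) (Tcoeff n k (L + 1) (N + n))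
      (Hspace n k N) (Tcoeff n k L N) (pmap n k N)"
    unfolding yangian_hom_def by (intro conjI ballI allI impI funcsetI pmap_Tcoeff pmap_add pmap_Const_mult)
next
  fix ip \<sigma> assume "fock_inner n (N + n) ip \<and> perp_section ip n k N \<sigma>"
  then show "yangian_hom n (Hspace n k N) (Tcoeff n k L N)
      (Hspace n k (N + n)) (Tcoeff n k (L + 1) (N + n)) \<sigma>"
    by (elim conjE) (rule perp_section_hom)
qed

end
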